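(* Let $r\ge2$ and let $\mathcal H$ be the Hecke algebra of $G(r,1,2)$ with its fixed reduced basis $B$. Write $d\longrightarrow d'$ for $\langle s\rangle d\langle s\rangle\longrightarrow\langle s\rangle d'\langle s\rangle$. The non-trivial arrows of the $\mathcal H$-double coset graph for $\langle s\rangle$-$\langle s\rangle$ double cosets are as follows, for $r-1\ge a\ge b\ge 1$ (loops being disregarded): If $a+b\le r$: $t^ast^b\longrightarrow t^{a+b-i}st^i$ for $1\le i\le b$. If $a+b>r$: $t^ast^b\longrightarrow t^i$ for $1\le i\le a+b-r$; $t^ast^b\longrightarrow t^xst^i$ for $1\le i\le a+b-r$ and $i<x\le r-1$; and $t^ast^b\longrightarrow t^{a+b-i}st^i$ for $a+b-r<i\le b$.
   Context: $G(r,1,2)=\langle s,t\mid s^2=t^r=1,\ stst=tsts\rangle$. Let $R=\mathbb Z[\xi_s,\xi_{t,1},\dots,\xi_{t,r-1}]$ be a polynomial ring in indeterminates. The Hecke algebra $\mathcal H$ of $G(r,1,2)$ is the $R$-algebra generated by $\tilde T_s,\tilde T_t$ subject to $\tilde T_s\tilde T_t\tilde T_s\tilde T_t=\tilde T_t\tilde T_s\tilde T_t\tilde T_s$, $\tilde T_s^2=1+\xi_s\tilde T_s$ and $\tilde T_t^r=1+\sum_{i=1}^{r-1}\xi_{t,i}\tilde T_t^{\,i}$. For a word $x_1\cdots x_k$ in $s,t$, $\tilde T_{x_1\cdots x_k}=\tilde T_{x_1}\cdots\tilde T_{x_k}$. $\mathcal H$ is free over $R$ with the fixed reduced basis $B$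 consisting of $\tilde T_{t^a},\tilde T_{t^as}$ ($0\le a\le r-1$) and $\tilde T_{t^ast^b},\tilde T_{t^ast^bs}$ ($0\le a\le r-1$, $1\le b\le r-1$); it has exactly one element $\tilde T_{w,B}$ for each $w\in G(r,1,2)$. For $J\subseteq\{s,t\}$ let $W_J=\langle J\rangle$, let $\mathcal H_J$ be the subalgebra generated by $\tilde T_x$, $x\in J$, and for $d\in G(r,1,2)$ let $\mathcal H_{W_JdW_J}$ be the $R$-span of $\{\tilde T_{w,B}\mid w\in W_JdW_J\}$. The $\mathcal H$-double coset graph is the directed graph whose vertices are the double cosets $W_JdW_J$, represented by minimal length elements $d$, with an arrow $W_JdW_J\to W_Jd'W_J$ when some element of $\mathcal H_J\tilde T_{d,B}\mathcal H_J$, expanded in $B$, has a non-zero coefficient at some $\tilde T_{w,B}$ with $w\in W_Jd'W_J$. Every vertex has a loop (a trivial arrow). Here $J=\{s\}$ and the minimal length representatives used are $1$, $t^a$ ($1\le a\le r-1$) and $t^ast^b$ ($1\le b\le a\le r-1$). *)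

theory Defs
  imports
    "HOL-Algebra.QuotRing"
    "HOL-Algebra.Generated_Rings"
    "HOL-Algebra.Module"
    "HOL-Library.Poly_Mapping"
    "Graph_Theory.Pair_Digraph"
begin

section \<open>The group $G(r,1,2)$\<close>

datatype gen = Gs | Gt

abbreviation tpow :: "nat \<Rightarrow> gen list" where
  "tpow a \<equiv> replicate a Gt"

text \<open>
  The group is presented by words in the positive letters only. As the relators make
  both generators of finite order, the monoid with this presentation is the group with
  this presentation.
\<close>

inductive_set grp_rel :: "nat \<Rightarrow> (gen list \<times> gen list) set" for r :: nat where
  s_order: "([Gs, Gs], []) \<in> grp_rel r"
| t_order: "(tpow r, []) \<in> grp_rel r"
| braid: "([Gs, Gt, Gs, Gt], [Gt, Gs, Gt, Gs]) \<in> grp_rel r"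
| refl: "(u, u) \<in> grp_rel r"
| sym: "(u, v) \<in> grp_rel r \<Longrightarrow> (v, u) \<in> grp_rel r"
| trans: "(u, v) \<in> grp_rel r \<Longrightarrow> (v, w) \<in> grp_rel r \<Longrightarrow> (u, w) \<in> grp_rel r"
| mult: "(u, v) \<in> grp_rel r \<Longrightarrow> (u', v') \<in> grp_rel r \<Longrightarrow> (u @ u', v @ v') \<in> grp_rel r"

definition grp_class :: "nat \<Rightarrow> gen list \<Rightarrow> gen list set" where
  "grp_class r u = grp_rel r `` {u}"

definition grp :: "nat \<Rightarrow> gen list set monoid" where
  "grp r = \<lparr>carrier = UNIV // grp_rel r,
            monoid.mult = (\<lambda>A B. \<Union>u\<in>A. \<Union>v\<in>B. grp_class r (u @ v)),
            monoid.one = grp_class r []\<rparr>"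

definition parabolic :: "nat \<Rightarrow> gen set \<Rightarrow> gen list set set" where
  "parabolic r J = generate (grp r) ((\<lambda>x. grp_class r [x]) ` J)"

definition double_coset :: "nat \<Rightarrow> gen set \<Rightarrow> gen list set \<Rightarrow> gen list set set" where
  "double_coset r J d =
     parabolic r J <#>\<^bsub>grp r\<^esub> {d} <#>\<^bsub>grp r\<^esub> parabolic r J"


section \<open>The coefficient ring and the free algebra\<close>

text \<open>
  The type of coefficients has infinitely many indeterminates;
  the ring $R$ is the subring of polynomials in $\xi_s, \xi_{t,1}, \dots, \xi_{t,r-1}$.
\<close>

datatype indet = Xi_s | Xi_t nat

type_synonym coef = "(indet \<Rightarrow>\<^sub>0 nat) \<Rightarrow>\<^sub>0 int"

definition indet :: "indet \<Rightarrow> coef" where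
  "indet v = Poly_Mapping.single (Poly_Mapping.single v 1) 1"

definition coef_ring :: "nat \<Rightarrow> coef set" where
  "coef_ring r = {p. \<forall>m \<in> Poly_Mapping.keys p.
      Poly_Mapping.keys m \<subseteq> insert Xi_s (Xi_t ` {1..r - 1})}"

text \<open>
  Words under concatenation, written additively, so that multiplication of
  finitely supported functions on words is that of the free associative algebra.
\<close>

datatype word = Word (letters: "gen list")

instantiation word :: monoid_add
begin

definition zero_word :: word where
  "0 = Word []"

definition plus_word :: "word \<Rightarrow> word \<Rightarrow> word" where
  "u + v = Word (letters u @ letters v)"

instance
  by standard (simp_all add: zero_word_def plus_word_def)

end

type_synonym free = "word \<Rightarrow>\<^sub>0 coef"

definition free_gen :: "gen \<Rightarrow> free" where
  "free_gen x = Poly_Mapping.single (Word [x]) 1"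

definition free_const :: "coef \<Rightarrow> free" where
  "free_const c = Poly_Mapping.single 0 c"

definition free_alg :: "nat \<Rightarrow> free ring" where
  "free_alg r = \<lparr>carrier = {f. \<forall>w. Poly_Mapping.lookup f w \<in> coef_ring r},
                 monoid.mult = (*), monoid.one = 1, ring.zero = 0, ring.add = (+)\<rparr>"


section \<open>The Hecke algebra\<close>

definition hecke_relators :: "nat \<Rightarrow> free set" where
  "hecke_relators r = (let S = free_gen Gs; T = free_gen Gt in
     {S * T * S * T - T * S * T * S,
      S ^ 2 - (1 + free_const (indet Xi_s) * S),
      T ^ r - (1 + (\<Sum>i = 1..r - 1. free_const (indet (Xi_t i)) * T ^ i))})"

definition hecke_ideal :: "nat \<Rightarrow> free set" where
  "hecke_ideal r = Idl\<^bsub>free_alg r\<^esub> (hecke_relators r)"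

definition hecke_proj :: "nat \<Rightarrow> free \<Rightarrow> free set" where
  "hecke_proj r f = hecke_ideal r +>\<^bsub>free_alg r\<^esub> f"

definition hecke :: "nat \<Rightarrow> (coef, free set) module" where
  "hecke r = (let Q = free_alg r Quot hecke_ideal r in
     ring.extend Q (module.fields (\<lambda>c h. hecke_proj r (free_const c) \<otimes>\<^bsub>Q\<^esub> h)))"

definition hecke_gen :: "nat \<Rightarrow> gen \<Rightarrow> free set" where
  "hecke_gen r x = hecke_proj r (free_gen x)"

definition hecke_word :: "nat \<Rightarrow> gen list \<Rightarrow> free set" where
  "hecke_word r u = foldr (\<lambda>x h. hecke_gen r x \<otimes>\<^bsub>hecke r\<^esub> h) u \<one>\<^bsub>hecke r\<^esub>"

definition basis_words :: "nat \<Rightarrow> gen list set" where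
  "basis_words r =
     {tpow a | a. a \<le> r - 1} \<union>
     {tpow a @ [Gs] | a. a \<le> r - 1} \<union>
     {tpow a @ [Gs] @ tpow b | a b. a \<le> r - 1 \<and> 1 \<le> b \<and> b \<le> r - 1} \<union>
     {tpow a @ [Gs] @ tpow b @ [Gs] | a b. a \<le> r - 1 \<and> 1 \<le> b \<and> b \<le> r - 1}"

text \<open>The element $\tilde T_{w,B}$ of the reduced basis $B$, for a group element $w$.\<close>

definition hecke_basis :: "nat \<Rightarrow> gen list set \<Rightarrow> free set" where
  "hecke_basis r w = hecke_word r (THE u. u \<in> basis_words r \<and> grp_class r u = w)"

definition basis_expansion ::
    "nat \<Rightarrow> free set \<Rightarrow> (gen list set \<Rightarrow> coef) \<Rightarrow> bool" where
  "basis_expansion r h c \<longleftrightarrow>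
     c \<in> carrier (grp r) \<rightarrow> coef_ring r \<and>
     h = (\<Oplus>\<^bsub>hecke r\<^esub>w \<in> carrier (grp r). c w \<odot>\<^bsub>hecke r\<^esub> hecke_basis r w)"


section \<open>The double coset graph\<close>

definition hecke_parabolic :: "nat \<Rightarrow> gen set \<Rightarrow> free set set" where
  "hecke_parabolic r J = generate_ring (hecke r)
     ((\<lambda>c. c \<odot>\<^bsub>hecke r\<^esub> \<one>\<^bsub>hecke r\<^esub>) ` coef_ring r \<union> hecke_gen r ` J)"

text \<open>
  The additive subgroup generated by the products $x \tilde T_{d,B} y$ with
  $x, y \in \mathcal H_J$; it is an $R$-submodule because $\mathcal H_J$ contains $R$.
\<close>

definition hecke_bimodule :: "nat \<Rightarrow> gen set \<Rightarrow> gen list set \<Rightarrow> free set set" where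
  "hecke_bimodule r J d = generate (add_monoid (hecke r))
     {x \<otimes>\<^bsub>hecke r\<^esub> hecke_basis r d \<otimes>\<^bsub>hecke r\<^esub> y | x y.
        x \<in> hecke_parabolic r J \<and> y \<in> hecke_parabolic r J}"

text \<open>
  The parameter \<open>D\<close> is the chosen system of minimal length representatives of the
  double cosets.
\<close>

definition double_coset_graph ::
    "nat \<Rightarrow> gen set \<Rightarrow> gen list set set \<Rightarrow> gen list set set pair_pre_digraph" where
  "double_coset_graph r J D =
     \<lparr>pverts = double_coset r J ` carrier (grp r),
      parcs = {(double_coset r J d, double_coset r J d') | d d'.
        d \<in> D \<and> d' \<in> carrier (grp r) \<and>
        (\<exists>h \<in> hecke_bimodule r J d. \<exists>c. basis_expansion r h c \<and>
           (\<exists>w \<in> double_coset r J d'. c w \<noteq> 0))}\<rparr>"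

definition s_reps :: "nat \<Rightarrow> gen list set set" where
  "s_reps r = grp_class r `
     ({[]} \<union>
      {tpow a | a. 1 \<le> a \<and> a \<le> r - 1} \<union>
      {tpow a @ [Gs] @ tpow b | a b. 1 \<le> b \<and> b \<le> a \<and> a \<le> r - 1})"

definition coset_of :: "nat \<Rightarrow> gen list \<Rightarrow> gen list set set" where
  "coset_of r u = double_coset r {Gs} (grp_class r u)"

end

theory Submission
  imports Defs
begin

text \<open>
  Up to the term $t^a = t^a s t^0 s - \xi_s t^a s t^0$, the Hecke algebra has the $R$-basis
  $t^a s t^b s^e$ with $0 \le a, b < r$ and $e \in \{0, 1\}$, and the double coset of such an
  element is the unordered pair of $a$ and $b$. Induction on the braid relation gives
  \[ s t^a s t^b = t^b s t^a s + \xi_s \sum_{i=1}^b (t^{a+b-i} s t^i - t^i s t^{a+b-i}), \]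
  and the arrows are read off after reducing the powers $t^n$ with $n \ge r$.

  Independence of the basis is obtained from the transpose of left multiplication. It acts on
  double sequences that satisfy the linear recurrence of $t^r = 1 + \sum_i \xi_{t,i} t^i$ in both
  arguments, where the defining relations become identities between finite sums along
  antidiagonals and no polynomial has to be reduced. Recurrent sequences with prescribed initial
  values are then the coordinate functions.

  For $n \ge r$ all coefficients of the reduction of $t^n$ are non-zero, and two of them with
  different indices and different $n$ do not cancel: at $\xi_{t,i} = 1$ they are positive and
  strictly increasing.
\<close>

subsection \<open>Linear extension\<close>

text \<open>For J = {s} the algebra H_J is R + R T_s, so the bimodule of d is spanned by D, DS, SD
  and SDS, where D is the basis element of d. Right multiplication by S keeps a and b; only left
  multiplication by S leaves the double coset, through the antisymmetric sum in the displayed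
  formula. Its reduced coefficient at t^x s t^y is \<open>kappa\<close>, and between distinct double
  cosets an arrow exists exactly when \<open>kappa\<close> is non-zero. The formula is needed on
  both sides of the duality. As a congruence modulo the ideal it shows that SD has an expansion at
  all, which an arrow demands. In transposed form it gives linear forms on the quotient, and these
  fix the coefficients of every expansion. Writing t^a as t^a s t^0 s - xi_s t^a s t^0 removes the
  exceptional case b = 0: s then treats all triples (e, a, b) alike, and the price is paid once,
  when coefficients are compared with the reduced basis.\<close>

lemma poly_mapping_single_induct [case_names single plus]:
  assumes single: "\<And>k v. P (Poly_Mapping.single k v)"
    and plus: "\<And>p q. P p \<Longrightarrow> P q \<Longrightarrow> P (p + q)"
  shows "P (p :: 'a \<Rightarrow>\<^sub>0 'b::comm_monoid_add)"
proof (induction p rule: update_induct)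
  case const
  show ?case using single[of undefined 0] by simp
next
  case (update p k v)
  have "Poly_Mapping.update k v p = p + Poly_Mapping.single k v"
    using update.hyps
    by (intro poly_mapping_eqI)
      (auto simp: lookup_update lookup_add lookup_single when_def in_keys_iff)
  then show ?case using plus[OF update.IH single] by simp
qed

definition lin_ext :: "('a \<Rightarrow> 'b \<Rightarrow> 'c) \<Rightarrow> ('a \<Rightarrow>\<^sub>0 'b::zero) \<Rightarrow> 'c::comm_monoid_add" where
  "lin_ext f p = (\<Sum>k \<in> Poly_Mapping.keys p. f k (Poly_Mapping.lookup p k))"

lemma lin_ext_single: "f k 0 = 0 \<Longrightarrow> lin_ext f (Poly_Mapping.single k v) = f k v"
  by (simp add: lin_ext_def)

lemma lin_ext_add:
  assumes "\<And>k. f k 0 = 0" "\<And>k v w. f k (v + w) = f k v + f k w"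
  shows "lin_ext f (p + q) = lin_ext f p + lin_ext f q"
  unfolding lin_ext_def by (rule setsum_keys_plus_distrib) (simp_all add: assms)


subsection \<open>Powers of $t$\<close>

text \<open>Index 0 carries the constant term 1, so that the relation for t^r becomes one
  homogeneous recurrence over all i < r.\<close>

definition xi :: "nat \<Rightarrow> coef" where
  "xi i = (if i = 0 then 1 else indet (Xi_t i))"

text \<open>\<open>tcoef r x n\<close> is the coefficient of $t^x$ in the reduction of $t^n$.\<close>

primrec tcoef :: "nat \<Rightarrow> nat \<Rightarrow> nat \<Rightarrow> coef" where
  "tcoef r x 0 = (if x = 0 then 1 else 0)"
| "tcoef r x (Suc n) = (if x = 0 then 0 else tcoef r (x - 1) n) + xi x * tcoef r (r - 1) n"

lemma tcoef_less: "n < r \<Longrightarrow> x < r \<Longrightarrow> tcoef r x n = (if x = n then 1 else 0)"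
  by (induction n arbitrary: x) auto

text \<open>The step from n to n + 1 in \<open>tcoef\<close> is linear with coefficients independent
  of n, so it preserves the recurrence; only n = 0 has to be computed.\<close>

lemma tcoef_rec: "0 < r \<Longrightarrow> x < r \<Longrightarrow> tcoef r x (n + r) = (\<Sum>i<r. xi i * tcoef r x (n + i))"
proof (induction n arbitrary: x)
  case 0
  obtain k where k: "r = Suc k" using 0 by (cases r) auto
  have "tcoef r x (0 + r) = (if x = 0 then 0 else tcoef r (x - 1) k) + xi x * tcoef r (r - 1) k"
    unfolding k by simp
  also have "\<dots> = xi x" using 0 k by (auto simp: tcoef_less)
  also have "\<dots> = (\<Sum>i<r. xi i * tcoef r x i)"
  proof -
    have "(\<Sum>i<r. xi i * tcoef r x i) = (\<Sum>i<r. if i = x then xi i else 0)"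
      using 0 by (intro sum.cong) (auto simp: tcoef_less)
    then show ?thesis using 0 by simp
  qed
  finally show ?case by simp
next
  case (Suc n)
  have "tcoef r x (Suc n + r) = (if x = 0 then 0 else tcoef r (x - 1) (n + r)) + xi x * tcoef r (r - 1) (n + r)"
    by simp
  also have "\<dots> = (\<Sum>i<r. xi i * tcoef r x (Suc n + i))"
    using Suc by (auto simp: sum_distrib_left sum.distrib algebra_simps)
  finally show ?case .
qed

text \<open>The sum of the coefficients, that is, evaluation with every indeterminate set to 1. It
  is a ring homomorphism to the integers and serves to certify that a polynomial is
  non-zero.\<close>

definition aug :: "coef \<Rightarrow> int" where
  "aug = lin_ext (\<lambda>m c. c)"

lemma aug_add: "aug (p + q) = aug p + aug q"
  unfolding aug_def by (rule lin_ext_add) auto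

lemma aug_single [simp]: "aug (Poly_Mapping.single k v) = v"
  unfolding aug_def by (rule lin_ext_single) auto

lemma aug_mult: "aug (p * q) = aug p * aug q"
proof (induction p rule: poly_mapping_single_induct)
  case (single k v)
  show ?case
    by (induction q rule: poly_mapping_single_induct) (auto simp: mult_single aug_add algebra_simps)
qed (auto simp: aug_add algebra_simps)

lemma aug_0 [simp]: "aug 0 = 0" using aug_single[of 0 0] by (simp del: aug_single)
lemma aug_1 [simp]: "aug 1 = 1" using aug_single[of 0 1] by (simp del: aug_single)
lemma aug_diff: "aug (p - q) = aug p - aug q" using aug_add[of "p - q" q] by simp
lemma aug_uminus: "aug (- p) = - aug p" using aug_diff[of 0 p] by simp
lemma aug_indet [simp]: "aug (indet v) = 1" by (simp add: indet_def)
lemma aug_xi [simp]: "aug (xi i) = 1" by (simp add: xi_def)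

lemma aug_tcoef_Suc:
  "aug (tcoef r x (Suc n)) = (if x = 0 then 0 else aug (tcoef r (x - 1) n)) + aug (tcoef r (r - 1) n)"
  by (simp add: aug_add aug_mult)

lemma aug_tcoef_pos:
  assumes "0 < r" "x < r" "r \<le> n" shows "aug (tcoef r x n) > 0"
  using assms(3,2)
proof (induction n arbitrary: x rule: dec_induct)
  case base
  then obtain k where "r = Suc k" by (cases r) auto
  then show ?case using base by (simp add: aug_add aug_mult tcoef_less split: if_splits)
next
  case (step n)
  have "aug (tcoef r (r - 1) n) > 0" using step assms by simp
  moreover have "(if x = 0 then 0 else aug (tcoef r (x - 1) n)) \<ge> 0"
    using step.IH[of "x - 1"] step.prems by (auto intro: less_imp_le)
  ultimately show ?case unfolding aug_tcoef_Suc by linarith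
qed

lemma aug_tcoef_mono_index:
  assumes "0 < r" "y \<le> x" "x < r" "r \<le> n"
  shows "aug (tcoef r y n) \<le> aug (tcoef r x n)"
  using assms(4,2,3)
proof (induction n arbitrary: x y rule: dec_induct)
  case base
  then obtain k where "r = Suc k" by (cases r) auto
  then show ?case using base by (auto simp: aug_add aug_mult tcoef_less)
next
  case (step n)
  have "(if y = 0 then 0 else aug (tcoef r (y - 1) n)) \<le> (if x = 0 then 0 else aug (tcoef r (x - 1) n))"
    using step.IH[of "y - 1" "x - 1"] step.prems aug_tcoef_pos[of r "x - 1" n] step.hyps
    by (auto intro: less_imp_le)
  then show ?case unfolding aug_tcoef_Suc by linarith
qed

lemma aug_tcoef_last_mono:
  assumes "0 < r" "r \<le> m" "m \<le> n"
  shows "aug (tcoef r (r - 1) m) \<le> aug (tcoef r (r - 1) n)"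
  using assms(3)
proof (induction n rule: dec_induct)
  case (step n)
  have "(if r - 1 = 0 then 0 else aug (tcoef r (r - 1 - 1) n)) \<ge> 0"
    using aug_tcoef_pos[of r "r - 1 - 1" n] step assms by (auto intro: less_imp_le)
  then show ?case using step.IH aug_tcoef_Suc[of r "r - 1" n] by linarith
qed simp

text \<open>The chain passes through the top index r - 1: it has the largest value at a fixed
  exponent and does not decrease with the exponent. The recursion at n adds to it the value at x -
  1, which is positive; y < x ensures that x - 1 exists.\<close>

lemma aug_tcoef_less:
  assumes "y < x" "x < r" "r \<le> m" "m < n"
  shows "aug (tcoef r y m) < aug (tcoef r x n)"
proof -
  obtain k where k: "n = Suc k" using assms by (cases n) auto
  have "aug (tcoef r y m) \<le> aug (tcoef r (r - 1) m)"
    using assms by (intro aug_tcoef_mono_index) auto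
  also have "\<dots> \<le> aug (tcoef r (r - 1) k)"
    using assms k by (intro aug_tcoef_last_mono) auto
  also have "\<dots> < aug (tcoef r x n)"
    using aug_tcoef_pos[of r "x - 1" k] assms unfolding k aug_tcoef_Suc by auto
  finally show ?thesis .
qed


subsection \<open>A right action on double sequences\<close>

text \<open>If v a b is the value of a linear form on t^a s t^b, this is its value on the correction
  sum in the formula for s t^a s t^b. All its terms lie on the antidiagonal of a + b.\<close>

definition diag :: "(nat \<Rightarrow> nat \<Rightarrow> coef) \<Rightarrow> nat \<Rightarrow> nat \<Rightarrow> coef" where
  "diag v a b = (\<Sum>i = 1..b. v (a + b - i) i - v i (a + b - i))"

lemma diag_0 [simp]: "diag v a 0 = 0"
  by (simp add: diag_def)

lemma diag_Suc: "diag v a (Suc b) = diag v (Suc a) b + v a (Suc b) - v (Suc b) a"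
  by (simp add: diag_def)

lemma diag_add: "diag (\<lambda>a b. v a b + w a b) a b = diag v a b + diag w a b"
  by (simp add: diag_def sum.distrib[symmetric] algebra_simps)

lemma diag_scale: "diag (\<lambda>a b. c * v a b) a b = c * diag v a b"
  by (simp add: diag_def sum_distrib_left algebra_simps)

lemma diag_flip: "diag (\<lambda>a b. v b a) a b = - diag v a b"
  by (simp add: diag_def sum_negf[symmetric])

text \<open>On one antidiagonal both halves of \<open>diag\<close> are partial sums of a single
  sequence \<open>p\<close>. The ranges {1..c} and {c..<n} together give {..<n} with 0 removed and c
  counted once more, so all but the terms at a and b cancels.\<close>

lemma diag_swap: "diag v a b - diag v b a = v a b - v b a"
proof -
  define n where "n = a + b"
  define p where "p i = v (n - i) i" for i
  have half: "diag v c d = sum p {1..d} - sum p {c..<n}" if "c + d = n" for c d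
  proof -
    have "(\<Sum>i = 1..d. v i (n - i)) = sum p {c..<n}"
      using that by (intro sum.reindex_bij_witness[of _ "\<lambda>i. n - i" "\<lambda>i. n - i"]) (auto simp: p_def)
    then show ?thesis using that by (simp add: diag_def sum_subtractf p_def)
  qed
  have split: "sum p {1..c} + sum p {c..<n} = p c - p 0 + sum p {..<n}" if "c \<le> n" for c
  proof -
    have "sum p {..<n} = sum p {..<c} + sum p {c..<n}"
      using that sum.atLeastLessThan_concat[of 0 c n p] by (simp add: atLeast0LessThan)
    moreover have "sum p {..c} = p 0 + sum p {1..c}"
      by (simp add: atMost_atLeast0 sum.atLeast_Suc_atMost)
    moreover have "sum p {..c} = sum p {..<c} + p c"
      by (simp flip: lessThan_Suc_atMost)
    ultimately show ?thesis by (simp add: algebra_simps)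
  qed
  have "diag v a b - diag v b a =
      (sum p {1..b} + sum p {b..<n}) - (sum p {1..a} + sum p {a..<n})"
    using half[of a b] half[of b a] by (simp add: n_def)
  also have "\<dots> = p b - p a"
    by (subst (1 2) split) (simp_all add: n_def)
  finally have "diag v a b - diag v b a = p b - p a" .
  then show ?thesis by (simp add: p_def n_def)
qed

text \<open>\<open>diag\<close> sees only the antisymmetric part of its argument, and by
  \<open>diag_swap\<close> the functions v and \<open>diag v\<close> have the same one.\<close>

lemma diag_diag: "diag (diag v) a b = diag v a b"
  unfolding diag_def[of "diag v"] by (simp add: diag_swap) (simp add: diag_def)

text \<open>The shifted function is symmetric in its two arguments, and \<open>diag\<close> kills
  symmetric functions term by term.\<close>

lemma diag_shift_diag: "diag (\<lambda>a b. diag v (Suc a) b) a b = 0"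
proof -
  have "diag v (Suc m) i = diag v (Suc i) m" for m i
    using diag_swap[of v "Suc m" i] diag_Suc[of v i m] by (simp add: algebra_simps)
  then show ?thesis by (simp add: diag_def[of "\<lambda>a b. diag v (Suc a) b"])
qed

text \<open>An index shift matches all terms of the two sums except the first of one half and the
  last of the other.\<close>

lemma diag_shift_right:
  "diag v a (Suc b) - diag (\<lambda>a b. v a (Suc b)) a b = v (a + b) 1 - v (Suc b) a"
proof (induction b arbitrary: a)
  case (Suc b)
  show ?case using Suc[of "Suc a"]
    by (simp add: diag_Suc[of v a "Suc b"] diag_Suc[of "\<lambda>a b. v a (Suc b)" a b] algebra_simps)
qed (simp add: diag_Suc)

abbreviation xi_s :: coef where "xi_s \<equiv> indet Xi_s"

section \<open>The operators of s and t, and the relations between them\<close>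

type_synonym seqs = "bool \<Rightarrow> nat \<Rightarrow> nat \<Rightarrow> coef"

text \<open>The value of \<open>act x u\<close> at (e, a, b) is that of u on x t^a s t^b s^e. The
  summand for e comes from s^2 = 1 + xi_s s at the right end. Being a transpose, it is a right
  action, so words act through \<open>fold\<close> with the first letter first.\<close>

fun act :: "gen \<Rightarrow> seqs \<Rightarrow> seqs" where
  "act Gt u e a b = u e (Suc a) b"
| "act Gs u e a b = xi_s * diag (u e) a b + u (\<not> e) b a + (if e then xi_s * u True b a else 0)"

lemma act_add: "act x (\<lambda>e a b. u e a b + v e a b) = (\<lambda>e a b. act x u e a b + act x v e a b)"
  by (cases x) (auto simp: fun_eq_iff diag_add algebra_simps)

lemma act_scale: "act x (\<lambda>e a b. c * u e a b) = (\<lambda>e a b. c * act x u e a b)"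
  by (cases x) (auto simp: fun_eq_iff diag_scale algebra_simps)

lemma fold_act_add:
  "fold act w (\<lambda>e a b. u e a b + v e a b) = (\<lambda>e a b. fold act w u e a b + fold act w v e a b)"
  by (induction w arbitrary: u v) (simp_all add: act_add)

lemma fold_act_scale:
  "fold act w (\<lambda>e a b. c * u e a b) = (\<lambda>e a b. c * fold act w u e a b)"
  by (induction w arbitrary: u) (simp_all add: act_scale)

text \<open>Applying \<open>diag\<close> twice gives \<open>diag\<close> again, and exchanging the
  arguments changes its sign; what is left agrees by \<open>diag_swap\<close>.\<close>

lemma act_s_s: "act Gs (act Gs u) e a b = u e a b + xi_s * act Gs u e a b"
proof -
  have d: "diag (act Gs u e) a b =
      xi_s * diag (u e) a b - diag (u (\<not> e)) a b - (if e then xi_s * diag (u e) a b else 0)"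
  proof -
    have "act Gs u e = (\<lambda>a b. xi_s * diag (u e) a b + (u (\<not> e) b a + (if e then xi_s else 0) * u e b a))"
      by (auto simp: fun_eq_iff)
    then show ?thesis
      by (simp add: diag_add diag_scale diag_diag diag_flip[of "u e"] diag_flip[of "u (\<not> e)"]
          diag_flip[of "\<lambda>a b. u e a b"])
  qed
  have s: "diag v b a = diag v a b - v a b + v b a" for v
    using diag_swap[of v a b] by (simp add: algebra_simps)
  show ?thesis
    unfolding act.simps(2)[of "act Gs u"] d
    by (cases e) (simp_all add: s[of "u True"] s[of "u False"] algebra_simps)
qed

text \<open>For e = False this is the transpose of sts t^a s t^b = t^a s t^(b+1) + xi_s t^(a+b) s t
  s. All sums have collapsed, and raising a by one can be done before or after; thus sts commutes
  with t, which is the braid relation.\<close>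

lemma act_s_t_s:
  "act Gs (act Gt (act Gs u)) e a b =
     u e a (Suc b) + xi_s * u (\<not> e) (a + b) 1 + (if e then xi_s * xi_s * u e (a + b) 1 else 0)"
proof -
  have d: "diag (act Gt (act Gs u) e) a b =
      - diag (\<lambda>a b. u (\<not> e) a (Suc b)) a b - (if e then xi_s * diag (\<lambda>a b. u e a (Suc b)) a b else 0)"
  proof -
    have "act Gt (act Gs u) e = (\<lambda>a b. xi_s * diag (u e) (Suc a) b +
        (u (\<not> e) b (Suc a) + (if e then xi_s else 0) * u e b (Suc a)))"
      by (auto simp: fun_eq_iff)
    then show ?thesis
      using diag_flip[of "\<lambda>a b. u e a (Suc b)" a b] diag_flip[of "\<lambda>a b. u (\<not> e) a (Suc b)" a b]
      by (simp add: diag_add diag_scale diag_shift_diag)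
  qed
  have s: "diag v (Suc b) a = diag v a (Suc b) - v a (Suc b) + v (Suc b) a" for v
    using diag_swap[of v a "Suc b"] by (simp add: algebra_simps)
  have y: "diag (\<lambda>a b. v a (Suc b)) a b = diag v a (Suc b) - v (a + b) 1 + v (Suc b) a" for v
    using diag_shift_right[of v a b] by (simp add: algebra_simps)
  show ?thesis
    unfolding act.simps(2)[of "act Gt (act Gs u)"] d
    by (cases e) (simp_all add: s[of "u True"] s[of "u False"] y[of "u True"] y[of "u False"] algebra_simps)
qed

lemma act_braid:
  "act Gt (act Gs (act Gt (act Gs u))) = act Gs (act Gt (act Gs (act Gt u)))"
  by (simp only: fun_eq_iff act_s_t_s act.simps(1)) simp

definition recurrent :: "nat \<Rightarrow> seqs \<Rightarrow> bool" where
  "recurrent r u \<longleftrightarrow> (\<forall>e a b. u e (a + r) b = (\<Sum>i<r. xi i * u e (a + i) b) \<and>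
     u e a (b + r) = (\<Sum>i<r. xi i * u e a (b + i)))"

lemma diag_recurrent_left:
  assumes l: "\<And>a b. v (a + r) b = (\<Sum>i<r. xi i * v (a + i) b)"
    and r: "\<And>a b. v a (b + r) = (\<Sum>i<r. xi i * v a (b + i))"
  shows "diag v (a + r) b = (\<Sum>i<r. xi i * diag v (a + i) b)"
proof -
  have "diag v (a + r) b = (\<Sum>j = 1..b. \<Sum>i<r. xi i * (v (a + i + b - j) j - v j (a + i + b - j)))"
    unfolding diag_def
  proof (rule sum.cong)
    fix j assume "j \<in> {1..b}"
    then have "a + r + b - j = (a + b - j) + r" "\<And>i. a + i + b - j = (a + b - j) + i" by auto
    then show "v (a + r + b - j) j - v j (a + r + b - j)
        = (\<Sum>i<r. xi i * (v (a + i + b - j) j - v j (a + i + b - j)))"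
      by (simp add: l r sum_subtractf right_diff_distrib)
  qed simp
  also have "\<dots> = (\<Sum>i<r. xi i * diag v (a + i) b)"
    unfolding diag_def sum_distrib_left by (rule sum.swap)
  finally show ?thesis .
qed

lemma recurrent_act: "recurrent r u \<Longrightarrow> recurrent r (act x u)"
proof (cases x)
  case Gs
  assume u: "recurrent r u"
  note rec = u[unfolded recurrent_def, rule_format]
  have l: "diag (u e) (a + r) b = (\<Sum>i<r. xi i * diag (u e) (a + i) b)" for e a b
    by (rule diag_recurrent_left) (simp_all add: rec)
  \<comment> \<open>In the first argument the range of summation is fixed and the recurrence holds
    term by term. In the second the range moves with b, so the recurrence is carried over by
    exchanging the arguments.\<close>
  have s: "diag v a b = diag v b a + v a b - v b a" for v a b
    using diag_swap[of v a b] by (simp add: algebra_simps)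
  have r: "diag (u e) a (b + r) = (\<Sum>i<r. xi i * diag (u e) a (b + i))" for e a b
    unfolding s[of _ a] l by (simp add: rec sum.distrib sum_subtractf algebra_simps)
  show ?thesis
    unfolding Gs recurrent_def
    by (simp add: l r rec sum.distrib sum_distrib_left algebra_simps)
qed (simp add: recurrent_def flip: add_Suc)

lemma recurrent_fold_act: "recurrent r u \<Longrightarrow> recurrent r (fold act w u)"
  by (induction w arbitrary: u) (simp_all add: recurrent_act)

definition acts :: "free \<Rightarrow> seqs \<Rightarrow> seqs" where
  "acts f u = (\<lambda>e a b. lin_ext (\<lambda>w c. c * fold act (letters w) u e a b) f)"

lemma acts_single: "acts (Poly_Mapping.single w c) u = (\<lambda>e a b. c * fold act (letters w) u e a b)"
  by (simp add: acts_def lin_ext_single)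

lemma acts_add: "acts (f + g) u = (\<lambda>e a b. acts f u e a b + acts g u e a b)"
  by (simp add: acts_def lin_ext_add algebra_simps)

lemma acts_seq_add: "acts f (\<lambda>e a b. u e a b + v e a b) = (\<lambda>e a b. acts f u e a b + acts f v e a b)"
  by (induction f rule: poly_mapping_single_induct)
    (simp_all add: acts_single acts_add fold_act_add algebra_simps)

lemma acts_seq_scale: "acts f (\<lambda>e a b. c * u e a b) = (\<lambda>e a b. c * acts f u e a b)"
  by (induction f rule: poly_mapping_single_induct)
    (simp_all add: acts_single acts_add fold_act_scale algebra_simps)

lemma acts_mult: "acts (f * g) u = acts g (acts f u)"
proof (induction f rule: poly_mapping_single_induct)
  case (single w c)
  show ?case
    by (induction g rule: poly_mapping_single_induct)
      (simp_all add: acts_single acts_add fold_act_scale mult_single plus_word_def algebra_simps)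
qed (simp_all add: acts_add acts_seq_add distrib_right)

lemma acts_0: "acts 0 u = (\<lambda>e a b. 0)"
  using acts_single[of 0 0 u] by simp

lemma acts_zero_seq: "acts f (\<lambda>e a b. 0) = (\<lambda>e a b. 0)"
  using acts_seq_scale[of f 0 "\<lambda>e a b. 0"] by simp

lemma acts_uminus: "acts (- f) u = (\<lambda>e a b. - acts f u e a b)"
proof -
  have "acts (- f) u e a b + acts f u e a b = 0" for e a b
    using fun_cong[OF fun_cong[OF fun_cong[OF acts_add[of "- f" f u]]], of e a b] by (simp add: acts_0)
  then show ?thesis by (simp add: fun_eq_iff eq_neg_iff_add_eq_0)
qed

lemma acts_diff: "acts (f - g) u = (\<lambda>e a b. acts f u e a b - acts g u e a b)"
  using acts_add[of f "- g" u] by (simp add: acts_uminus)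

lemma acts_sum: "acts (\<Sum>i\<in>I. f i) u = (\<lambda>e a b. \<Sum>i\<in>I. acts (f i) u e a b)"
  by (induction I rule: infinite_finite_induct) (simp_all add: acts_0 acts_add)

lemma acts_const: "acts (free_const c) u = (\<lambda>e a b. c * u e a b)"
  by (simp add: free_const_def acts_single zero_word_def)

lemma acts_gen: "acts (free_gen x) u = act x u"
  by (simp add: free_gen_def acts_single)

lemma acts_1: "acts 1 u = u"
  using acts_const[of 1 u] by (simp add: free_const_def)

lemma acts_gen_power: "acts (free_gen Gt ^ n) u = (\<lambda>e a b. u e (a + n) b)"
  by (induction n arbitrary: u) (simp_all add: acts_1 acts_mult acts_gen fun_eq_iff)

lemma recurrent_acts: "recurrent r u \<Longrightarrow> recurrent r (acts f u)"
proof (induction f rule: poly_mapping_single_induct)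
  case (single w c)
  then show ?case
    using recurrent_fold_act[OF single, of "letters w"]
    by (simp add: acts_single recurrent_def sum_distrib_left mult.left_commute)
next
  case (plus f g)
  then show ?case
    unfolding recurrent_def acts_add by (simp add: sum.distrib distrib_left)
qed

lemma acts_relator:
  assumes "2 \<le> r" "recurrent r u" "f \<in> hecke_relators r"
  shows "acts f u = (\<lambda>e a b. 0)"
proof -
  consider "f = free_gen Gs * free_gen Gt * free_gen Gs * free_gen Gt
        - free_gen Gt * free_gen Gs * free_gen Gt * free_gen Gs"
    | "f = free_gen Gs ^ 2 - (1 + free_const xi_s * free_gen Gs)"
    | "f = free_gen Gt ^ r - (1 + (\<Sum>i = 1..r - 1. free_const (indet (Xi_t i)) * free_gen Gt ^ i))"
    using assms(3) by (auto simp: hecke_relators_def Let_def)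
  then show ?thesis
  proof cases
    case 1
    show ?thesis
      unfolding 1 acts_diff acts_mult acts_gen act_braid by simp
  next
    case 2
    show ?thesis
      unfolding 2 acts_diff acts_add power2_eq_square acts_mult acts_gen acts_1 acts_const
        act_s_s act_scale by (simp add: fun_eq_iff)
  next
    case 3
    have "{..<r} = insert 0 {1..r - 1}" using assms(1) by auto
    then have "u e (a + r) b = u e a b + (\<Sum>i = 1..r - 1. indet (Xi_t i) * u e (a + i) b)" for e a b
      using assms(2) by (simp add: recurrent_def) (simp add: xi_def)
    then show ?thesis
      unfolding 3 acts_diff acts_add acts_mult acts_1 acts_const acts_sum acts_gen_power
      by (simp add: fun_eq_iff)
  qed
qed


subsection \<open>Normal forms in the group\<close>

type_synonym nform = "bool \<times> nat \<times> nat"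

definition nforms :: "nat \<Rightarrow> nform set" where
  "nforms r = UNIV \<times> {..<r} \<times> {..<r}"

text \<open>The triple \<open>(e, a, b)\<close> stands for $t^a s t^b s^e$, which is $t^a$ for \<open>(True, a, 0)\<close>.\<close>

fun nf_word :: "nform \<Rightarrow> gen list" where
  "nf_word (e, a, b) =
     (if e \<and> b = 0 then tpow a else tpow a @ [Gs] @ tpow b @ (if e then [Gs] else []))"

lemma mem_nforms [simp]: "(e, a, b) \<in> nforms r \<longleftrightarrow> a < r \<and> b < r"
  by (simp add: nforms_def)

lemma basis_words_eq:
  assumes "0 < r" shows "basis_words r = nf_word ` nforms r"
proof
  have le: "b \<le> r - 1 \<longleftrightarrow> b < r" for b using assms by auto
  show "basis_words r \<subseteq> nf_word ` nforms r"
  proof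
    fix w assume "w \<in> basis_words r"
    then consider a where "w = tpow a" "a < r" | a where "w = tpow a @ [Gs]" "a < r"
      | a b where "w = tpow a @ [Gs] @ tpow b" "a < r" "1 \<le> b" "b < r"
      | a b where "w = tpow a @ [Gs] @ tpow b @ [Gs]" "a < r" "1 \<le> b" "b < r"
      using le unfolding basis_words_def by fast
    then show "w \<in> nf_word ` nforms r"
    proof cases
      case (1 a) then show ?thesis using assms by (intro image_eqI[of _ _ "(True, a, 0)"]) auto
    next
      case (2 a) then show ?thesis using assms by (intro image_eqI[of _ _ "(False, a, 0)"]) auto
    next
      case (3 a b) then show ?thesis by (intro image_eqI[of _ _ "(False, a, b)"]) auto
    next
      case (4 a b) then show ?thesis by (intro image_eqI[of _ _ "(True, a, b)"]) auto
    qed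
  qed
  show "nf_word ` nforms r \<subseteq> basis_words r"
  proof (rule image_subsetI)
    fix x assume "x \<in> nforms r"
    then obtain e a b where x: "x = (e, a, b)" "a \<le> r - 1" "b \<le> r - 1"
      using assms by (cases x) auto
    consider "b = 0" "e" | "b = 0" "\<not> e" | "1 \<le> b" "e" | "1 \<le> b" "\<not> e" by linarith
    then show "nf_word x \<in> basis_words r"
    proof cases
      case 1
      then have "nf_word x = tpow a" by (simp add: x)
      then show ?thesis unfolding basis_words_def using x 1 by blast
    next
      case 2
      then have "nf_word x = tpow a @ [Gs]" by (simp add: x)
      then show ?thesis unfolding basis_words_def using x 2 by blast
    next
      case 3
      then have "nf_word x = tpow a @ [Gs] @ tpow b @ [Gs]" by (simp add: x)
      then show ?thesis unfolding basis_words_def using x 3 by blast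
    next
      case 4
      then have "nf_word x = tpow a @ [Gs] @ tpow b" by (simp add: x)
      then show ?thesis unfolding basis_words_def using x 4 by blast
    qed
  qed
qed

text \<open>Left multiplication on triples, where the correction terms of the Hecke algebra are
  absent. The triple (True, 0, 0) is the identity, and a normal word moves it to its own triple;
  this separates the classes of normal words.\<close>

fun nf_act :: "nat \<Rightarrow> gen \<Rightarrow> nform \<Rightarrow> nform" where
  "nf_act r Gs (e, a, b) = (\<not> e, b, a)"
| "nf_act r Gt (e, a, b) = (e, Suc a mod r, b)"

lemma nf_act_closed: "x \<in> nforms r \<Longrightarrow> nf_act r g x \<in> nforms r"
  by (cases x; cases g) auto

lemma foldr_nf_act_closed: "x \<in> nforms r \<Longrightarrow> foldr (nf_act r) w x \<in> nforms r"
  by (induction w) (simp_all add: nf_act_closed)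

lemma funpow_nf_act:
  "a < r \<Longrightarrow> (nf_act r Gt ^^ n) (e, a, b) = (e, (a + n) mod r, b)"
  by (induction n) (simp_all add: mod_Suc_eq)

lemma foldr_nf_act_nf_word:
  "x \<in> nforms r \<Longrightarrow> foldr (nf_act r) (nf_word x) (True, 0, 0) = x"
  by (cases x) (simp add: funpow_nf_act)

lemma grp_rel_nf_act:
  "(u, v) \<in> grp_rel r \<Longrightarrow> \<forall>x \<in> nforms r. foldr (nf_act r) u x = foldr (nf_act r) v x"
proof (induction rule: grp_rel.induct)
  case t_order
  then show ?case by (auto simp: nforms_def funpow_nf_act)
next
  case (mult u v u' v')
  then show ?case by (simp add: foldr_nf_act_closed)
qed (auto simp: nforms_def)

definition grp_eq :: "gen list \<Rightarrow> nat \<Rightarrow> gen list \<Rightarrow> bool"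
    ("(_ \<approx>\<^bsub>_\<^esub> _)" [51, 0, 51] 50) where
  "u \<approx>\<^bsub>r\<^esub> v \<longleftrightarrow> (u, v) \<in> grp_rel r"

lemma grp_eq_refl [simp, intro]: "u \<approx>\<^bsub>r\<^esub> u"
  by (simp add: grp_eq_def grp_rel.refl)

lemma grp_eq_sym: "u \<approx>\<^bsub>r\<^esub> v \<Longrightarrow> v \<approx>\<^bsub>r\<^esub> u"
  unfolding grp_eq_def by (rule grp_rel.sym)

lemma grp_eq_trans [trans]: "u \<approx>\<^bsub>r\<^esub> v \<Longrightarrow> v \<approx>\<^bsub>r\<^esub> w \<Longrightarrow> u \<approx>\<^bsub>r\<^esub> w"
  unfolding grp_eq_def by (rule grp_rel.trans)

lemma grp_eq_mult: "u \<approx>\<^bsub>r\<^esub> v \<Longrightarrow> u' \<approx>\<^bsub>r\<^esub> v' \<Longrightarrow> u @ u' \<approx>\<^bsub>r\<^esub> v @ v'"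
  unfolding grp_eq_def by (rule grp_rel.mult)

lemmas grp_eq_s_s = grp_rel.s_order[folded grp_eq_def]
lemmas grp_eq_t_r = grp_rel.t_order[folded grp_eq_def]
lemmas grp_eq_braid = grp_rel.braid[folded grp_eq_def]

lemma grp_eq_append: "u \<approx>\<^bsub>r\<^esub> v \<Longrightarrow> p @ u @ q \<approx>\<^bsub>r\<^esub> p @ v @ q"
  by (intro grp_eq_mult) auto

lemma grp_eq_appendL: "u \<approx>\<^bsub>r\<^esub> v \<Longrightarrow> p @ u \<approx>\<^bsub>r\<^esub> p @ v"
  by (intro grp_eq_mult) auto

lemma grp_eq_appendR: "u \<approx>\<^bsub>r\<^esub> v \<Longrightarrow> u @ q \<approx>\<^bsub>r\<^esub> v @ q"
  by (intro grp_eq_mult) auto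

lemma tpow_snoc: "tpow (Suc a) = tpow a @ [Gt]"
  using replicate_append_same[of a Gt] by simp

text \<open>Inserting ss factors s t^(a+1) s as (s t^a s)(s t s). The second factor commutes with t
  by the braid relation, the first by induction.\<close>

lemma grp_eq_sts_t: "[Gs] @ tpow a @ [Gs, Gt] \<approx>\<^bsub>r\<^esub> [Gt, Gs] @ tpow a @ [Gs]"
proof (induction a)
  case 0
  have "[Gs, Gs] @ [Gt] \<approx>\<^bsub>r\<^esub> [] @ [Gt]" by (intro grp_eq_appendR grp_eq_s_s)
  moreover have "[Gt] @ [] \<approx>\<^bsub>r\<^esub> [Gt] @ [Gs, Gs]" by (intro grp_eq_appendL grp_eq_sym[OF grp_eq_s_s])
  ultimately show ?case by (auto intro: grp_eq_trans)
next
  case (Suc a)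
  have "[Gs] @ tpow (Suc a) @ [Gs, Gt] = ([Gs] @ tpow a) @ [] @ [Gt, Gs, Gt]"
    by (simp add: tpow_snoc del: replicate.simps)
  also have "\<dots> \<approx>\<^bsub>r\<^esub> ([Gs] @ tpow a) @ [Gs, Gs] @ [Gt, Gs, Gt]"
    by (intro grp_eq_append grp_eq_sym[OF grp_eq_s_s])
  also have "\<dots> = ([Gs] @ tpow a @ [Gs]) @ [Gs, Gt, Gs, Gt]" by simp
  also have "\<dots> \<approx>\<^bsub>r\<^esub> ([Gs] @ tpow a @ [Gs]) @ [Gt, Gs, Gt, Gs]"
    by (intro grp_eq_appendL grp_eq_braid)
  also have "\<dots> = ([Gs] @ tpow a @ [Gs, Gt]) @ [Gs, Gt, Gs]" by simp
  also have "\<dots> \<approx>\<^bsub>r\<^esub> ([Gt, Gs] @ tpow a @ [Gs]) @ [Gs, Gt, Gs]"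
    by (intro grp_eq_appendR Suc)
  also have "\<dots> = ([Gt, Gs] @ tpow a) @ [Gs, Gs] @ [Gt, Gs]" by simp
  also have "\<dots> \<approx>\<^bsub>r\<^esub> ([Gt, Gs] @ tpow a) @ [] @ [Gt, Gs]"
    by (intro grp_eq_append grp_eq_s_s)
  also have "\<dots> = [Gt, Gs] @ tpow (Suc a) @ [Gs]"
    by (simp add: tpow_snoc del: replicate.simps)
  finally show ?case .
qed

lemma grp_eq_sts_tpow: "[Gs] @ tpow a @ [Gs] @ tpow b \<approx>\<^bsub>r\<^esub> tpow b @ [Gs] @ tpow a @ [Gs]"
proof (induction b)
  case (Suc b)
  have "[Gs] @ tpow a @ [Gs] @ tpow (Suc b) = ([Gs] @ tpow a @ [Gs] @ tpow b) @ [Gt]"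
    by (simp add: tpow_snoc del: replicate.simps)
  also have "\<dots> \<approx>\<^bsub>r\<^esub> (tpow b @ [Gs] @ tpow a @ [Gs]) @ [Gt]"
    by (intro grp_eq_appendR Suc)
  also have "\<dots> = tpow b @ ([Gs] @ tpow a @ [Gs, Gt])" by simp
  also have "\<dots> \<approx>\<^bsub>r\<^esub> tpow b @ ([Gt, Gs] @ tpow a @ [Gs])"
    by (intro grp_eq_appendL grp_eq_sts_t)
  also have "\<dots> = tpow (Suc b) @ [Gs] @ tpow a @ [Gs]"
    by (simp add: tpow_snoc del: replicate.simps)
  finally show ?case .
qed simp

text \<open>Spells t^a as t^a s s, so that multiplication by s on either side needs no separate case
  for b = 0.\<close>

definition nf_long :: "nform \<Rightarrow> gen list" where
  "nf_long x = (case x of (e, a, b) \<Rightarrow> tpow a @ [Gs] @ tpow b @ (if e then [Gs] else []))"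

lemma nf_word_long: "nf_word x \<approx>\<^bsub>r\<^esub> nf_long x"
proof (cases x)
  case (fields e a b)
  then show ?thesis
    using grp_eq_appendL[OF grp_eq_sym[OF grp_eq_s_s], of "tpow a" r] by (simp add: nf_long_def)
qed

lemma grp_eq_nf_long_right: "nf_long (e, a, b) @ [Gs] \<approx>\<^bsub>r\<^esub> nf_long (\<not> e, a, b)"
  using grp_eq_appendL[OF grp_eq_s_s, of "tpow a @ [Gs] @ tpow b" r] by (simp add: nf_long_def)

lemma grp_eq_nf_long_left: "[Gs] @ nf_long (e, a, b) \<approx>\<^bsub>r\<^esub> nf_long (\<not> e, b, a)"
proof -
  have "[Gs] @ nf_long (e, a, b) \<approx>\<^bsub>r\<^esub> nf_long (True, b, a) @ (if e then [Gs] else [])"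
    using grp_eq_appendR[OF grp_eq_sts_tpow[of a b r], of "if e then [Gs] else []"]
    by (simp add: nf_long_def)
  also have "\<dots> \<approx>\<^bsub>r\<^esub> nf_long (\<not> e, b, a)"
    using grp_eq_nf_long_right[of True b a r] by (auto simp: nf_long_def)
  finally show ?thesis .
qed

lemma grp_eq_nf_long_t:
  assumes "a < r" shows "[Gt] @ nf_long (e, a, b) \<approx>\<^bsub>r\<^esub> nf_long (e, Suc a mod r, b)"
proof (cases "Suc a = r")
  case True
  have "[Gt] @ nf_long (e, a, b) = tpow r @ nf_long (e, 0, b)"
    by (simp add: nf_long_def True[symmetric])
  also have "\<dots> \<approx>\<^bsub>r\<^esub> [] @ nf_long (e, 0, b)" by (intro grp_eq_appendR grp_eq_t_r)
  finally show ?thesis using True by simp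
qed (use assms in \<open>simp add: nf_long_def\<close>)

lemma grp_eq_nf_act_long: "x \<in> nforms r \<Longrightarrow> [g] @ nf_long x \<approx>\<^bsub>r\<^esub> nf_long (nf_act r g x)"
  by (cases x; cases g) (simp_all only: nf_act.simps grp_eq_nf_long_left grp_eq_nf_long_t mem_nforms)

lemma grp_eq_foldr_nf_act:
  assumes "0 < r" shows "w \<approx>\<^bsub>r\<^esub> nf_long (foldr (nf_act r) w (True, 0, 0))"
proof (induction w)
  case Nil
  then show ?case using grp_eq_sym[OF grp_eq_s_s] by (simp add: nf_long_def)
next
  case (Cons g w)
  have "g # w \<approx>\<^bsub>r\<^esub> [g] @ nf_long (foldr (nf_act r) w (True, 0, 0))"
    using grp_eq_appendL[OF Cons, of "[g]"] by simp
  also have "\<dots> \<approx>\<^bsub>r\<^esub> nf_long (nf_act r g (foldr (nf_act r) w (True, 0, 0)))"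
    by (intro grp_eq_nf_act_long foldr_nf_act_closed) (use assms in simp)
  finally show ?case by simp
qed

section \<open>Group elements as triples, products, and double cosets of the subgroup generated by
  s\<close>

lemma equiv_grp_rel: "equiv UNIV (grp_rel r)"
  by (intro equivI refl_onI symI transI) (auto intro: grp_rel.refl grp_rel.sym grp_rel.trans)

lemma grp_class_eq_iff: "grp_class r u = grp_class r v \<longleftrightarrow> u \<approx>\<^bsub>r\<^esub> v"
  unfolding grp_class_def grp_eq_def using equiv_grp_rel by (rule eq_equiv_class_iff) auto

definition nf_class :: "nat \<Rightarrow> nform \<Rightarrow> gen list set" where
  "nf_class r x = grp_class r (nf_word x)"

lemma nf_class_long: "nf_class r x = grp_class r (nf_long x)"
  by (simp add: nf_class_def grp_class_eq_iff nf_word_long)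

lemma inj_nf_class: "inj_on (nf_class r) (nforms r)"
proof (rule inj_onI)
  fix x y assume "x \<in> nforms r" "y \<in> nforms r" "nf_class r x = nf_class r y"
  moreover from this have "(True, 0, 0) \<in> nforms r" by (auto simp: nforms_def)
  ultimately show "x = y"
    using grp_rel_nf_act foldr_nf_act_nf_word by (metis nf_class_def grp_class_eq_iff grp_eq_def)
qed

lemma carrier_grp: "carrier (grp r) = range (grp_class r)"
  by (auto simp: grp_def quotient_def grp_class_def)

lemma carrier_grp_nf:
  assumes "0 < r" shows "carrier (grp r) = nf_class r ` nforms r"
proof -
  have "grp_class r w \<in> nf_class r ` nforms r" for w
    using grp_eq_foldr_nf_act[OF assms, of w]
      foldr_nf_act_closed[of "(True, 0, 0)" r w] assms
    unfolding nf_class_long by (auto simp flip: grp_class_eq_iff)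
  then show ?thesis by (auto simp: carrier_grp nf_class_def)
qed

lemma basis_word_nf_class:
  assumes "x \<in> nforms r"
  shows "(THE u. u \<in> basis_words r \<and> grp_class r u = nf_class r x) = nf_word x"
proof -
  have "0 < r" using assms by (auto simp: nforms_def)
  then show ?thesis
    using assms inj_nf_class[of r]
    by (intro the_equality) (auto simp: basis_words_eq nf_class_def inj_on_def)
qed

lemma hecke_basis_nf_class: "x \<in> nforms r \<Longrightarrow> hecke_basis r (nf_class r x) = hecke_word r (nf_word x)"
  by (simp add: hecke_basis_def basis_word_nf_class)

lemma grp_mult: "grp_class r u \<otimes>\<^bsub>grp r\<^esub> grp_class r v = grp_class r (u @ v)"
proof -
  have "grp_class r (u' @ v') = grp_class r (u @ v)"
    if "u' \<in> grp_class r u" "v' \<in> grp_class r v" for u' v'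
    using that unfolding grp_class_eq_iff
    by (auto simp: grp_class_def simp flip: grp_eq_def intro: grp_eq_sym grp_eq_mult)
  then have "grp_class r u \<otimes>\<^bsub>grp r\<^esub> grp_class r v =
      (\<Union>u'\<in>grp_class r u. \<Union>v'\<in>grp_class r v. grp_class r (u @ v))"
    unfolding grp_def by (simp cong: SUP_cong)
  moreover have "grp_class r u \<noteq> {}" "grp_class r v \<noteq> {}"
    using grp_rel.refl[of u r] grp_rel.refl[of v r] by (auto simp: grp_class_def)
  ultimately show ?thesis by simp
qed

lemma grp_one: "\<one>\<^bsub>grp r\<^esub> = grp_class r []"
  by (simp add: grp_def)

lemma monoid_grp: "Group.monoid (grp r)"
  by (rule monoidI) (auto simp: carrier_grp grp_one grp_mult)

lemma grp_s_s: "grp_class r [Gs] \<otimes>\<^bsub>grp r\<^esub> grp_class r [Gs] = \<one>\<^bsub>grp r\<^esub>"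
  using grp_eq_s_s by (simp add: grp_mult grp_one grp_class_eq_iff)

lemma inv_grp_s: "inv\<^bsub>grp r\<^esub> (grp_class r [Gs]) = grp_class r [Gs]"
  using monoid.inv_unique'[OF monoid_grp _ _ grp_s_s grp_s_s] by (simp add: carrier_grp)

lemma parabolic_s: "parabolic r {Gs} = {grp_class r [], grp_class r [Gs]}"
proof
  show "parabolic r {Gs} \<subseteq> {grp_class r [], grp_class r [Gs]}"
  proof
    fix x assume "x \<in> parabolic r {Gs}"
    then have "x \<in> generate (grp r) {grp_class r [Gs]}"
      by (simp add: parabolic_def)
    then show "x \<in> {grp_class r [], grp_class r [Gs]}"
    proof (induction rule: generate.induct)
      case (eng x y)
      have "grp_class r [Gs, Gs] = grp_class r []"
        using grp_s_s[of r] by (simp add: grp_mult grp_one)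
      with eng.IH show ?case by (elim insertE emptyE) (simp_all add: grp_mult)
    qed (simp_all add: grp_one inv_grp_s)
  qed
  show "{grp_class r [], grp_class r [Gs]} \<subseteq> parabolic r {Gs}"
    unfolding parabolic_def grp_one[symmetric] by (simp add: generate.one generate.incl)
qed

text \<open>
  Left and right multiplication by $s$ map \<open>(e, a, b)\<close> to \<open>(\<not> e, b, a)\<close> and \<open>(\<not> e, a, b)\<close>,
  so a double coset is determined by the unordered pair of \<open>a\<close> and \<open>b\<close>.
\<close>

lemma double_coset_nf:
  "double_coset r {Gs} (nf_class r (e, a, b)) =
     {nf_class r (e', a', b') | e' a' b'. (a', b') = (a, b) \<or> (a', b') = (b, a)}"
proof -
  have *: "nf_class r (e, a, b) \<otimes>\<^bsub>grp r\<^esub> grp_class r [Gs] = nf_class r (\<not> e, a, b)"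
      "grp_class r [Gs] \<otimes>\<^bsub>grp r\<^esub> nf_class r (e, a, b) = nf_class r (\<not> e, b, a)"
      "nf_class r (e, a, b) \<otimes>\<^bsub>grp r\<^esub> grp_class r [] = nf_class r (e, a, b)"
      "grp_class r [] \<otimes>\<^bsub>grp r\<^esub> nf_class r (e, a, b) = nf_class r (e, a, b)" for e a b
    unfolding nf_class_long grp_mult grp_class_eq_iff
    by (simp_all only: grp_eq_nf_long_left grp_eq_nf_long_right append_Nil append_Nil2 grp_eq_refl)
  have "double_coset r {Gs} (nf_class r (e, a, b)) =
     {nf_class r (e, a, b), nf_class r (\<not> e, a, b), nf_class r (\<not> e, b, a), nf_class r (e, b, a)}"
    unfolding double_coset_def parabolic_s set_mult_def by (simp add: *) blast
  also have "\<dots> = {nf_class r (e', a', b') | e' a' b'. (a', b') = (a, b) \<or> (a', b') = (b, a)}"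
    (is "?L = ?R")
  proof
    show "?L \<subseteq> ?R" by blast
    show "?R \<subseteq> ?L"
    proof
      fix w assume "w \<in> ?R"
      then obtain e' a' b' where w: "w = nf_class r (e', a', b')" "(a', b') = (a, b) \<or> (a', b') = (b, a)"
        by blast
      have "e' = e \<or> e' = (\<not> e)" by blast
      with w show "w \<in> ?L" by auto
    qed
  qed
  finally show ?thesis .
qed


subsection \<open>The Hecke algebra\<close>

lemma coef_ring_0 [simp]: "0 \<in> coef_ring r" by (simp add: coef_ring_def)

lemma coef_ring_1 [simp]: "1 \<in> coef_ring r" by (simp add: coef_ring_def)

lemma coef_ring_add [simp]: "p \<in> coef_ring r \<Longrightarrow> q \<in> coef_ring r \<Longrightarrow> p + q \<in> coef_ring r"
  using Poly_Mapping.keys_add[of p q] by (auto simp: coef_ring_def)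

lemma coef_ring_uminus [simp]: "p \<in> coef_ring r \<Longrightarrow> - p \<in> coef_ring r"
  by (simp add: coef_ring_def)

lemma coef_ring_mult [simp]:
  assumes "p \<in> coef_ring r" "q \<in> coef_ring r" shows "p * q \<in> coef_ring r"
  unfolding coef_ring_def
proof (intro CollectI ballI)
  fix m assume "m \<in> Poly_Mapping.keys (p * q)"
  then obtain a b where "m = a + b" "a \<in> Poly_Mapping.keys p" "b \<in> Poly_Mapping.keys q"
    using keys_mult[of p q] by blast
  then show "Poly_Mapping.keys m \<subseteq> insert Xi_s (Xi_t ` {1..r - 1})"
    using assms Poly_Mapping.keys_add[of a b] unfolding coef_ring_def by blast
qed

lemma coef_ring_sum: "(\<And>i. i \<in> I \<Longrightarrow> f i \<in> coef_ring r) \<Longrightarrow> sum f I \<in> coef_ring r"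
  by (induction I rule: infinite_finite_induct) simp_all

lemma coef_ring_xi_s [simp]: "xi_s \<in> coef_ring r"
  by (simp add: coef_ring_def indet_def)

lemma coef_ring_xi [simp]: "i < r \<Longrightarrow> xi i \<in> coef_ring r"
  by (simp add: coef_ring_def indet_def xi_def)

lemma coef_ring_tcoef [simp]: "x < r \<Longrightarrow> tcoef r x n \<in> coef_ring r"
  by (induction n arbitrary: x) auto

lemma carrier_free_alg: "carrier (free_alg r) = {f. \<forall>w. Poly_Mapping.lookup f w \<in> coef_ring r}"
  and mult_free_alg [simp]: "f \<otimes>\<^bsub>free_alg r\<^esub> g = f * g"
  and one_free_alg [simp]: "\<one>\<^bsub>free_alg r\<^esub> = 1"
  and add_free_alg [simp]: "f \<oplus>\<^bsub>free_alg r\<^esub> g = f + g"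
  and zero_free_alg [simp]: "\<zero>\<^bsub>free_alg r\<^esub> = 0"
  by (simp_all add: free_alg_def)

lemma free_alg_0 [simp]: "0 \<in> carrier (free_alg r)"
  and free_alg_add [simp]:
    "f \<in> carrier (free_alg r) \<Longrightarrow> g \<in> carrier (free_alg r) \<Longrightarrow> f + g \<in> carrier (free_alg r)"
  and free_alg_uminus [simp]: "f \<in> carrier (free_alg r) \<Longrightarrow> - f \<in> carrier (free_alg r)"
  by (simp_all add: carrier_free_alg lookup_add)

lemma free_alg_diff [simp]:
  "f \<in> carrier (free_alg r) \<Longrightarrow> g \<in> carrier (free_alg r) \<Longrightarrow> f - g \<in> carrier (free_alg r)"
  using free_alg_add[of f r "- g"] by simp

lemma free_alg_single [simp]: "c \<in> coef_ring r \<Longrightarrow> Poly_Mapping.single w c \<in> carrier (free_alg r)"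
  by (simp add: carrier_free_alg lookup_single when_def)

lemma free_alg_1 [simp]: "1 \<in> carrier (free_alg r)"
  using free_alg_single[of 1 r 0] by simp

lemma free_alg_mult [simp]:
  assumes "f \<in> carrier (free_alg r)" "g \<in> carrier (free_alg r)"
  shows "f * g \<in> carrier (free_alg r)"
proof -
  have Sum_any: "Sum_any F \<in> coef_ring r" if "\<And>a. F a \<in> coef_ring r" for F :: "word \<Rightarrow> coef"
    unfolding Sum_any.expand_set using that by (rule coef_ring_sum)
  show ?thesis
    using assms unfolding carrier_free_alg
    by (auto simp: lookup_mult prod_fun_def when_def intro!: Sum_any coef_ring_mult)
qed

lemma free_alg_sum [simp]:
  "(\<And>i. i \<in> I \<Longrightarrow> f i \<in> carrier (free_alg r)) \<Longrightarrow> sum f I \<in> carrier (free_alg r)"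
  by (induction I rule: infinite_finite_induct) simp_all

lemma free_alg_gen [simp]: "free_gen x \<in> carrier (free_alg r)"
  by (simp add: free_gen_def)

lemma free_alg_const [simp]: "c \<in> coef_ring r \<Longrightarrow> free_const c \<in> carrier (free_alg r)"
  by (simp add: free_const_def)

lemma free_alg_power [simp]: "f \<in> carrier (free_alg r) \<Longrightarrow> f ^ n \<in> carrier (free_alg r)"
  by (induction n) simp_all

lemma ring_free_alg: "ring (free_alg r)"
proof (rule ringI)
  show "abelian_group (free_alg r)"
    by (rule abelian_groupI) (auto simp: algebra_simps intro: exI[of _ "- x" for x] bexI[of _ "- x" for x])
  show "Group.monoid (free_alg r)"
    by (rule monoidI) (auto simp: algebra_simps)
qed (auto simp: algebra_simps)

lemma minus_free_alg:
  assumes "f \<in> carrier (free_alg r)" "g \<in> carrier (free_alg r)"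
  shows "f \<ominus>\<^bsub>free_alg r\<^esub> g = f - g"
proof -
  interpret ring "free_alg r" by (rule ring_free_alg)
  have "\<ominus>\<^bsub>free_alg r\<^esub> g = - g" by (rule minus_equality) (use assms in simp_all)
  then show ?thesis by (simp add: a_minus_def)
qed

lemma hecke_relators_carrier:
  assumes "0 < r" shows "hecke_relators r \<subseteq> carrier (free_alg r)"
proof -
  have "indet (Xi_t i) \<in> coef_ring r" if "i \<in> {1..r - 1}" for i
  proof -
    have "i < r" "i \<noteq> 0" using that assms by auto
    then show ?thesis using coef_ring_xi[of i r] by (simp add: xi_def)
  qed
  then show ?thesis
    by (auto simp: hecke_relators_def Let_def intro!: free_alg_sum free_alg_diff free_alg_add free_alg_mult)
qed

lemma ideal_hecke: "0 < r \<Longrightarrow> ideal (hecke_ideal r) (free_alg r)"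
  unfolding hecke_ideal_def by (intro ring.genideal_ideal ring_free_alg hecke_relators_carrier)

lemma relator_in_hecke_ideal: "0 < r \<Longrightarrow> hecke_relators r \<subseteq> hecke_ideal r"
  unfolding hecke_ideal_def by (intro ring.genideal_self ring_free_alg hecke_relators_carrier)

lemma hecke_ideal_0: "0 < r \<Longrightarrow> 0 \<in> hecke_ideal r"
  and hecke_ideal_add: "0 < r \<Longrightarrow> f \<in> hecke_ideal r \<Longrightarrow> g \<in> hecke_ideal r \<Longrightarrow> f + g \<in> hecke_ideal r"
  and hecke_ideal_mult_left:
    "0 < r \<Longrightarrow> f \<in> hecke_ideal r \<Longrightarrow> g \<in> carrier (free_alg r) \<Longrightarrow> g * f \<in> hecke_ideal r"
  and hecke_ideal_mult_right:
    "0 < r \<Longrightarrow> f \<in> hecke_ideal r \<Longrightarrow> g \<in> carrier (free_alg r) \<Longrightarrow> f * g \<in> hecke_ideal r"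
  using ideal.axioms(1)[OF ideal_hecke] ideal.I_l_closed[OF ideal_hecke] ideal.I_r_closed[OF ideal_hecke]
    additive_subgroup.zero_closed[of "hecke_ideal r" "free_alg r"]
    additive_subgroup.a_closed[of "hecke_ideal r" "free_alg r"]
  by force+

lemma hecke_ideal_uminus: "0 < r \<Longrightarrow> f \<in> hecke_ideal r \<Longrightarrow> - f \<in> hecke_ideal r"
  using hecke_ideal_mult_left[of r f "- 1"] by simp

lemma hecke_proj_eq_iff:
  assumes "0 < r" "f \<in> carrier (free_alg r)" "g \<in> carrier (free_alg r)"
  shows "hecke_proj r f = hecke_proj r g \<longleftrightarrow> f - g \<in> hecke_ideal r"
  using ring.quotient_eq_iff_same_a_r_cos[OF ring_free_alg ideal_hecke[OF assms(1)] assms(2,3)]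
  by (simp add: hecke_proj_def minus_free_alg assms)

lemma hecke_ideal_acts:
  assumes "2 \<le> r" "recurrent r u" "f \<in> hecke_ideal r"
  shows "acts f u = (\<lambda>e a b. 0)"
proof -
  \<comment> \<open>Quantifying over all recurrent u makes K closed under multiplication from the
    left: \<open>acts (g * f) u\<close> is \<open>acts f (acts g u)\<close>, and
    \<open>acts g u\<close> is recurrent again.\<close>
  define K where "K = {f \<in> carrier (free_alg r). \<forall>u. recurrent r u \<longrightarrow> acts f u = (\<lambda>e a b. 0)}"
  interpret R: ring "free_alg r" by (rule ring_free_alg)
  have neg: "\<ominus>\<^bsub>free_alg r\<^esub> f = - f" if "f \<in> carrier (free_alg r)" for f
    by (rule R.minus_equality) (use that in simp_all)
  have "ideal K (free_alg r)"
  proof (rule idealI)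
    show "subgroup K (add_monoid (free_alg r))"
    proof (rule R.add.subgroupI)
      show "K \<noteq> {}" using acts_0 free_alg_0 unfolding K_def by blast
    qed (auto simp: K_def acts_add acts_uminus neg simp flip: a_inv_def)
  qed (auto simp: K_def ring_free_alg acts_mult acts_zero_seq recurrent_acts)
  moreover have "hecke_relators r \<subseteq> K"
    using assms(1) hecke_relators_carrier[of r] acts_relator by (auto simp: K_def)
  ultimately have "hecke_ideal r \<subseteq> K"
    unfolding hecke_ideal_def by (rule R.genideal_minimal)
  then show ?thesis using assms(2,3) by (auto simp: K_def)
qed

definition free_word :: "gen list \<Rightarrow> free" where
  "free_word u = Poly_Mapping.single (Word u) 1"

lemma free_word_closed [simp]: "free_word u \<in> carrier (free_alg r)"
  by (simp add: free_word_def)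

lemma free_word_append: "free_word (u @ v) = free_word u * free_word v"
  by (simp add: free_word_def mult_single plus_word_def)

lemma free_word_Nil: "free_word [] = 1"
  by (simp add: free_word_def flip: zero_word_def)

lemma free_word_gen: "free_word [x] = free_gen x"
  by (simp add: free_word_def free_gen_def)

lemma free_word_Cons: "free_word (x # u) = free_gen x * free_word u"
  using free_word_append[of "[x]" u] by (simp add: free_word_gen)

lemma free_word_tpow: "free_word (tpow n) = free_gen Gt ^ n"
  by (induction n) (simp_all add: free_word_Nil free_word_Cons)

lemma carrier_hecke: "0 < r \<Longrightarrow> carrier (hecke r) = hecke_proj r ` carrier (free_alg r)"
  by (auto simp: hecke_def Let_def ring.defs FactRing_def A_RCOSETS_def' hecke_proj_def)

context
  fixes r :: nat
  assumes r: "0 < r"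
begin

lemma hecke_proj_closed [simp]: "f \<in> carrier (free_alg r) \<Longrightarrow> hecke_proj r f \<in> carrier (hecke r)"
  by (simp add: carrier_hecke[OF r])

lemma hecke_add:
  assumes "f \<in> carrier (free_alg r)" "g \<in> carrier (free_alg r)"
  shows "hecke_proj r f \<oplus>\<^bsub>hecke r\<^esub> hecke_proj r g = hecke_proj r (f + g)"
  using ideal.a_rcos_sum[OF ideal_hecke[OF r] assms]
  by (simp add: hecke_def Let_def ring.defs FactRing_def hecke_proj_def)

lemma hecke_mult:
  assumes "f \<in> carrier (free_alg r)" "g \<in> carrier (free_alg r)"
  shows "hecke_proj r f \<otimes>\<^bsub>hecke r\<^esub> hecke_proj r g = hecke_proj r (f * g)"
  using ideal.rcoset_mult_add[OF ideal_hecke[OF r] assms]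
  by (simp add: hecke_def Let_def ring.defs FactRing_def hecke_proj_def)

lemma hecke_one: "\<one>\<^bsub>hecke r\<^esub> = hecke_proj r 1"
  by (simp add: hecke_def Let_def ring.defs FactRing_def hecke_proj_def)

lemma hecke_zero: "\<zero>\<^bsub>hecke r\<^esub> = hecke_proj r 0"
  using ring.a_rcos_zero[OF ring_free_alg ideal_hecke[OF r] hecke_ideal_0[OF r]]
  by (simp add: hecke_def Let_def ring.defs FactRing_def hecke_proj_def)

lemma hecke_smult:
  assumes "c \<in> coef_ring r" "f \<in> carrier (free_alg r)"
  shows "c \<odot>\<^bsub>hecke r\<^esub> hecke_proj r f = hecke_proj r (free_const c * f)"
proof -
  have "c \<odot>\<^bsub>hecke r\<^esub> hecke_proj r f = hecke_proj r (free_const c) \<otimes>\<^bsub>hecke r\<^esub> hecke_proj r f"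
    by (simp add: hecke_def Let_def ring.defs module.defs)
  then show ?thesis using assms by (simp add: hecke_mult)
qed

lemma ring_hecke: "ring (hecke r)"
proof (rule ringI)
  have inv: "\<exists>y\<in>carrier (free_alg r). hecke_proj r (x + y) = hecke_proj r 0"
    if "x \<in> carrier (free_alg r)" for x
    using that by (intro bexI[of _ "- x"]) simp_all
  show "abelian_group (hecke r)"
    by (rule abelian_groupI) (auto simp: carrier_hecke[OF r] hecke_add hecke_zero inv algebra_simps)
  show "Group.monoid (hecke r)"
    by (rule monoidI) (auto simp: carrier_hecke[OF r] hecke_mult hecke_one algebra_simps)
qed (auto simp: carrier_hecke[OF r] hecke_mult hecke_add algebra_simps)

lemma hecke_uminus:
  assumes "f \<in> carrier (free_alg r)"
  shows "\<ominus>\<^bsub>hecke r\<^esub> hecke_proj r f = hecke_proj r (- f)"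
proof -
  interpret ring "hecke r" by (rule ring_hecke)
  show ?thesis by (rule minus_equality) (use assms in \<open>simp_all add: hecke_add hecke_zero\<close>)
qed

lemma hecke_finsum:
  assumes "finite A" "\<And>i. i \<in> A \<Longrightarrow> f i \<in> carrier (free_alg r)"
  shows "(\<Oplus>\<^bsub>hecke r\<^esub>i\<in>A. hecke_proj r (f i)) = hecke_proj r (\<Sum>i\<in>A. f i)"
proof -
  interpret ring "hecke r" by (rule ring_hecke)
  show ?thesis
    using assms
  proof (induction A rule: finite_induct)
    case (insert a A)
    have "(\<lambda>i. hecke_proj r (f i)) \<in> A \<rightarrow> carrier (hecke r)" using insert by auto
    then show ?case using insert by (simp add: hecke_add)
  qed (simp add: hecke_zero)
qed

lemma hecke_word_proj: "hecke_word r u = hecke_proj r (free_word u)"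
proof (induction u)
  case Nil
  then show ?case by (simp add: hecke_word_def hecke_one free_word_Nil)
next
  case (Cons x u)
  then show ?case by (simp add: hecke_word_def hecke_gen_def hecke_mult free_word_Cons)
qed

end

section \<open>Straightening of words modulo the Hecke ideal\<close>

lemma free_const_commute: "free_const c * f = f * free_const c"
  by (induction f rule: poly_mapping_single_induct)
    (simp_all add: free_const_def mult_single algebra_simps)

lemma free_const_mult: "free_const (c * d) = free_const c * free_const d"
  by (simp add: free_const_def mult_single)

lemma free_const_add: "free_const (c + d) = free_const c + free_const d"
  by (simp add: free_const_def single_add)

lemma free_const_1 [simp]: "free_const 1 = 1"
  by (simp add: free_const_def)

lemma free_const_0 [simp]: "free_const 0 = 0"
  by (simp add: free_const_def)

lemma hecke_proj_cong_mult:
  assumes "0 < r" "hecke_proj r f = hecke_proj r f'" "hecke_proj r g = hecke_proj r g'"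
    "f \<in> carrier (free_alg r)" "f' \<in> carrier (free_alg r)"
    "g \<in> carrier (free_alg r)" "g' \<in> carrier (free_alg r)"
  shows "hecke_proj r (f * g) = hecke_proj r (f' * g')"
  using assms by (simp flip: hecke_mult)

lemma hecke_proj_cong_add:
  assumes "0 < r" "hecke_proj r f = hecke_proj r f'" "hecke_proj r g = hecke_proj r g'"
    "f \<in> carrier (free_alg r)" "f' \<in> carrier (free_alg r)"
    "g \<in> carrier (free_alg r)" "g' \<in> carrier (free_alg r)"
  shows "hecke_proj r (f + g) = hecke_proj r (f' + g')"
  using assms by (simp flip: hecke_add)

text \<open>
  The certificate comes from $TST = (STST) S^{-1}$ with $S^{-1} = S - x$, whose defect is
  measured by the braid relator and the quadratic relator.
\<close>

lemma sts_t_step: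
  fixes S T P x :: "'a::ring_1"
  assumes x: "S * x = x * S" "T * x = x * T" "P * x = x * P"
  defines "braid \<equiv> S * T * S * T - T * S * T * S" and "quad \<equiv> S * S - (1 + x * S)"
  defines "A \<equiv> S * P * S * T - T * S * P * S - x * (P * S * T - T * S * P)"
  shows "S * (P * T) * S * T - T * S * (P * T) * S - x * ((P * T) * S * T - T * S * (P * T)) =
    A * (S * T * (S - x)) + T * S * P * quad * (T * (S - x)) + x * P * braid * (S - x)
    - S * P * braid * (S - x) + (x * P * T * S * T - S * P * T * S * T) * quad"
proof -
  have x': "S * (x * z) = x * (S * z)" "T * (x * z) = x * (T * z)" "P * (x * z) = x * (P * z)" for z
    using x by (metis mult.assoc)+
  show ?thesis
    unfolding braid_def quad_def A_def by (simp add: algebra_simps x x')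
qed

text \<open>One more T on the right extends the correction sum by D a (b+1) = D a b T + T^(a+b) S T
  - T^(b+1) S T^a: the first half gains the term i = 1, the second the term i = b + 1. The new terms
  are T^b times the correction for a single T.\<close>

lemma sts_tpow_step:
  fixes S T x :: "'a::ring_1"
  assumes x: "T * x = x * T"
  defines "D \<equiv> \<lambda>a b. \<Sum>i = 1..b. T ^ (a + b - i) * S * T ^ i - T ^ i * S * T ^ (a + b - i)"
  shows "S * T ^ a * S * T ^ Suc b - T ^ Suc b * S * T ^ a * S - x * D a (Suc b) =
    (S * T ^ a * S * T ^ b - T ^ b * S * T ^ a * S - x * D a b) * T +
    T ^ b * (S * T ^ a * S * T - T * S * T ^ a * S - x * (T ^ a * S * T - T * S * T ^ a))"
proof -
  have x': "T * (x * z) = x * (T * z)" for z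
    using x by (metis mult.assoc)
  have x'': "T ^ n * (x * z) = x * (T ^ n * z)" for n z
    by (induction n arbitrary: z) (simp_all add: x' mult.assoc)
  have comm: "T ^ n * (T * z) = T * (T ^ n * z)" for n z
    by (simp add: power_commutes flip: mult.assoc)
  have add: "T ^ b * (T ^ a * z) = T ^ (a + b) * z" for z
    by (simp add: power_add add.commute[of a] mult.assoc)
  have shift: "(\<Sum>i = 1..Suc b. g i) = g 1 + (\<Sum>i = 1..b. g (Suc i))" for g :: "nat \<Rightarrow> 'a"
    by (induction b) (simp_all add: add.assoc)
  have "D a (Suc b) = (\<Sum>i = 1..Suc b. T ^ (a + Suc b - i) * S * T ^ i)
      - (\<Sum>i = 1..Suc b. T ^ i * S * T ^ (a + Suc b - i))"
    unfolding D_def by (rule sum_subtractf)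
  also have "(\<Sum>i = 1..Suc b. T ^ (a + Suc b - i) * S * T ^ i) =
      T ^ (a + b) * S * T + (\<Sum>i = 1..b. T ^ (a + b - i) * S * T ^ i * T)"
    unfolding shift by (simp add: power_Suc2 mult.assoc del: power_Suc)
  also have "(\<Sum>i = 1..Suc b. T ^ i * S * T ^ (a + Suc b - i)) =
      (\<Sum>i = 1..b. T ^ i * S * T ^ (a + b - i) * T) + T ^ Suc b * S * T ^ a"
    by (simp add: Suc_diff_le power_Suc2 mult.assoc del: power_Suc)
  finally have D: "D a (Suc b) = D a b * T + T ^ (a + b) * S * T - T ^ Suc b * S * T ^ a"
    by (simp add: D_def sum_subtractf sum_distrib_right left_diff_distrib)
  show ?thesis
    unfolding D by (simp add: algebra_simps x x' x'' comm add power_commutes)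
qed

lemma hecke_sts_t:
  assumes "0 < r"
  shows "free_gen Gs * free_gen Gt ^ a * free_gen Gs * free_gen Gt
    - free_gen Gt * free_gen Gs * free_gen Gt ^ a * free_gen Gs
    - free_const xi_s * (free_gen Gt ^ a * free_gen Gs * free_gen Gt
        - free_gen Gt * free_gen Gs * free_gen Gt ^ a) \<in> hecke_ideal r"
proof -
  let ?S = "free_gen Gs" and ?T = "free_gen Gt" and ?x = "free_const xi_s"
  have braid: "?S * ?T * ?S * ?T - ?T * ?S * ?T * ?S \<in> hecke_ideal r"
    and quad: "?S * ?S - (1 + ?x * ?S) \<in> hecke_ideal r"
    using relator_in_hecke_ideal[OF assms] by (auto simp: hecke_relators_def Let_def power2_eq_square)
  have diff: "f - g \<in> hecke_ideal r" if "f \<in> hecke_ideal r" "g \<in> hecke_ideal r" for f g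
    using hecke_ideal_add[OF assms that(1) hecke_ideal_uminus[OF assms that(2)]] by simp
  show ?thesis
  proof (induction a)
    case 0
    \<comment> \<open>For a = 0 the expression is the commutator of the quadratic relator with
      T.\<close>
    have "?S * ?T ^ 0 * ?S * ?T - ?T * ?S * ?T ^ 0 * ?S - ?x * (?T ^ 0 * ?S * ?T - ?T * ?S * ?T ^ 0)
        = (?S * ?S - (1 + ?x * ?S)) * ?T - ?T * (?S * ?S - (1 + ?x * ?S))"
      using free_const_commute[of xi_s ?T] free_const_commute[of xi_s "?T * ?S"]
      by (simp add: algebra_simps flip: mult.assoc)
    then show ?case
      using quad assms by (simp add: diff hecke_ideal_mult_left hecke_ideal_mult_right)
  next
    case (Suc a)
    let ?P = "?T ^ a"
    let ?braid = "?S * ?T * ?S * ?T - ?T * ?S * ?T * ?S" and ?quad = "?S * ?S - (1 + ?x * ?S)"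
    let ?A = "?S * ?P * ?S * ?T - ?T * ?S * ?P * ?S - ?x * (?P * ?S * ?T - ?T * ?S * ?P)"
    have "?A * (?S * ?T * (?S - ?x)) \<in> hecke_ideal r"
      by (rule hecke_ideal_mult_right[OF assms Suc]) simp
    moreover have "?T * ?S * ?P * ?quad * (?T * (?S - ?x)) \<in> hecke_ideal r"
      by (rule hecke_ideal_mult_right[OF assms hecke_ideal_mult_left[OF assms quad]]) simp_all
    moreover have "?x * ?P * ?braid * (?S - ?x) \<in> hecke_ideal r"
      by (rule hecke_ideal_mult_right[OF assms hecke_ideal_mult_left[OF assms braid]]) simp_all
    moreover have "?S * ?P * ?braid * (?S - ?x) \<in> hecke_ideal r"
      by (rule hecke_ideal_mult_right[OF assms hecke_ideal_mult_left[OF assms braid]]) simp_all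
    moreover have "(?x * ?P * ?T * ?S * ?T - ?S * ?P * ?T * ?S * ?T) * ?quad \<in> hecke_ideal r"
      by (rule hecke_ideal_mult_left[OF assms quad]) simp
    ultimately show ?case
      unfolding power_Suc2
        sts_t_step[where P = ?P, OF free_const_commute[symmetric] free_const_commute[symmetric] free_const_commute[symmetric]]
      by (intro hecke_ideal_add diff assms)
  qed
qed

lemma hecke_sts_tpow:
  assumes "0 < r"
  shows "free_gen Gs * free_gen Gt ^ a * free_gen Gs * free_gen Gt ^ b
    - free_gen Gt ^ b * free_gen Gs * free_gen Gt ^ a * free_gen Gs
    - free_const xi_s * (\<Sum>i = 1..b. free_gen Gt ^ (a + b - i) * free_gen Gs * free_gen Gt ^ i
        - free_gen Gt ^ i * free_gen Gs * free_gen Gt ^ (a + b - i)) \<in> hecke_ideal r"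
proof (induction b)
  case 0
  then show ?case using assms by (simp add: hecke_ideal_0)
next
  case (Suc b)
  show ?case
    by (subst sts_tpow_step[OF free_const_commute[symmetric]])
      (intro hecke_ideal_add hecke_ideal_mult_right hecke_ideal_mult_left assms Suc hecke_sts_t
        free_alg_gen free_alg_power)
qed

text \<open>Multiplying the reduced form of t^n by T raises every exponent by one. Only the top term
  reaches T^r, and expanding it by the relator is the recursion of \<open>tcoef\<close>.\<close>

lemma hecke_tpow_reduce:
  assumes "0 < r"
  shows "free_gen Gt ^ n - (\<Sum>x<r. free_const (tcoef r x n) * free_gen Gt ^ x) \<in> hecke_ideal r"
proof -
  let ?T = "free_gen Gt"
  obtain k where k: "r = Suc k" using assms by (cases r) auto
  have "{..<r} = insert 0 {1..r - 1}" using k by auto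
  then have "(\<Sum>x<r. free_const (xi x) * ?T ^ x) = free_const (xi 0) * ?T ^ 0 + (\<Sum>i = 1..r - 1. free_const (xi i) * ?T ^ i)"
    by (simp only:) (rule sum.insert, simp_all)
  also have "(\<Sum>i = 1..r - 1. free_const (xi i) * ?T ^ i) = (\<Sum>i = 1..r - 1. free_const (indet (Xi_t i)) * ?T ^ i)"
    by (rule sum.cong) (simp_all add: xi_def)
  finally have "(\<Sum>x<r. free_const (xi x) * ?T ^ x) = 1 + (\<Sum>i = 1..r - 1. free_const (indet (Xi_t i)) * ?T ^ i)"
    by (simp add: xi_def)
  then have rel: "?T ^ r - (\<Sum>x<r. free_const (xi x) * ?T ^ x) \<in> hecke_ideal r"
    using relator_in_hecke_ideal[OF assms] by (auto simp: hecke_relators_def Let_def)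
  show ?thesis
  proof (induction n)
    case 0
    have "(\<Sum>x<r. free_const (tcoef r x 0) * ?T ^ x) = 1"
      unfolding k sum.lessThan_Suc_shift by simp
    then show ?case using assms by (simp add: hecke_ideal_0)
  next
    case (Suc n)
    have "(\<Sum>x<r. free_const (tcoef r x (Suc n)) * ?T ^ x) =
        (\<Sum>x<r. free_const (if x = 0 then 0 else tcoef r (x - 1) n) * ?T ^ x) +
        free_const (tcoef r (r - 1) n) * (\<Sum>x<r. free_const (xi x) * ?T ^ x)"
      unfolding sum_distrib_left sum.distrib[symmetric]
      by (intro sum.cong) (simp_all add: free_const_add mult.commute[of "xi _"] free_const_mult distrib_right mult.assoc)
    also have "(\<Sum>x<r. free_const (if x = 0 then 0 else tcoef r (x - 1) n) * ?T ^ x) =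
        (\<Sum>x<k. free_const (tcoef r x n) * ?T ^ Suc x)"
      unfolding k sum.lessThan_Suc_shift by simp
    also have "\<dots> = ?T * (\<Sum>x<r. free_const (tcoef r x n) * ?T ^ x) - free_const (tcoef r (r - 1) n) * ?T ^ r"
    proof -
      have "?T * (free_const c * ?T ^ x) = free_const c * ?T ^ Suc x" for c x
        using free_const_commute[of c ?T] by (simp add: mult.assoc[symmetric])
      then show ?thesis unfolding sum_distrib_left by (simp add: k)
    qed
    finally have "?T ^ Suc n - (\<Sum>x<r. free_const (tcoef r x (Suc n)) * ?T ^ x) =
        ?T * (?T ^ n - (\<Sum>x<r. free_const (tcoef r x n) * ?T ^ x)) +
        free_const (tcoef r (r - 1) n) * (?T ^ r - (\<Sum>x<r. free_const (xi x) * ?T ^ x))"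
      by (simp add: algebra_simps)
    moreover have "free_const (tcoef r (r - 1) n) \<in> carrier (free_alg r)" using assms by simp
    ultimately show ?case
      using Suc rel assms by (simp add: hecke_ideal_add hecke_ideal_mult_left del: power_Suc)
  qed
qed


subsection \<open>Coordinate functionals\<close>

text \<open>
  A sequence is a linear form on the span of the $t^a s t^b s^e$; it is evaluated at
  $1 = s t^0 s - \xi_s\, s t^0$.
\<close>

definition val :: "seqs \<Rightarrow> free \<Rightarrow> coef" where
  "val u f = acts f u True 0 0 - xi_s * acts f u False 0 0"

lemma val_add: "val u (f + g) = val u f + val u g"
  by (simp add: val_def acts_add algebra_simps)

lemma val_uminus: "val u (- f) = - val u f"
  by (simp add: val_def acts_uminus algebra_simps)

lemma val_sum: "val u (\<Sum>i\<in>I. f i) = (\<Sum>i\<in>I. val u (f i))"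
  by (simp add: val_def acts_sum sum_subtractf sum_distrib_left)

lemma val_const: "val u (free_const c * f) = c * val u f"
  by (simp add: val_def acts_mult acts_const acts_seq_scale algebra_simps)

lemma val_hecke_cong:
  assumes "2 \<le> r" "recurrent r u" "hecke_proj r f = hecke_proj r g"
    "f \<in> carrier (free_alg r)" "g \<in> carrier (free_alg r)"
  shows "val u f = val u g"
proof -
  have "f - g \<in> hecke_ideal r" using assms by (simp add: hecke_proj_eq_iff)
  then have "acts (f - g) u = (\<lambda>e a b. 0)" using assms by (intro hecke_ideal_acts) auto
  then show ?thesis by (simp add: acts_diff val_def fun_eq_iff)
qed

lemma val_gen_left: "val u (free_gen x * f) = val (act x u) f"
  by (simp add: val_def acts_mult acts_gen)

lemma val_tpow: "val u (free_gen Gt ^ a) = u True a 0 - xi_s * u False a 0"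
  by (simp add: val_def acts_gen_power)

lemma val_tst: "val u (free_gen Gt ^ a * free_gen Gs * free_gen Gt ^ b) = u False a b"
  by (simp add: val_def acts_mult acts_gen_power acts_gen)

lemma val_tsts: "val u (free_gen Gt ^ a * free_gen Gs * free_gen Gt ^ b * free_gen Gs) = u True a b"
  by (simp add: val_def acts_mult acts_gen_power acts_gen)

lemma val_nf_word:
  "val u (free_word (nf_word (e, a, b))) =
     (if e \<and> b = 0 then u True a 0 - xi_s * u False a 0 else u e a b)"
  using val_tst[of u a b] val_tsts[of u a b]
  by (auto simp: free_word_append free_word_Cons free_word_Nil free_word_tpow val_tpow mult.assoc)

text \<open>The coordinate function of a triple, continued to all exponents: each factor
  \<open>tcoef\<close> solves the recurrence in its own argument and is a Kronecker delta below
  r.\<close>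

definition delta :: "nat \<Rightarrow> nform \<Rightarrow> seqs" where
  "delta r z e a b = (case z of (e', x, y) \<Rightarrow> if e = e' then tcoef r x a * tcoef r y b else 0)"

lemma recurrent_delta:
  assumes "z \<in> nforms r" shows "recurrent r (delta r z)"
proof -
  obtain e' x y where z: "z = (e', x, y)" "x < r" "y < r" "0 < r"
    using assms by (cases z) auto
  then show ?thesis
    by (auto simp: recurrent_def delta_def tcoef_rec sum_distrib_left sum_distrib_right algebra_simps)
qed

lemma delta_nf:
  "z \<in> nforms r \<Longrightarrow> a < r \<Longrightarrow> b < r \<Longrightarrow> delta r z e a b = (if (e, a, b) = z then 1 else 0)"
  by (cases z) (auto simp: delta_def tcoef_less)


subsection \<open>Expansions in the reduced basis\<close>

abbreviation rep :: "nat \<Rightarrow> gen list set \<Rightarrow> gen list" where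
  "rep r w \<equiv> THE u. u \<in> basis_words r \<and> grp_class r u = w"

lemma finite_nforms: "finite (nforms r)"
  by (simp add: nforms_def)

lemma finite_carrier_grp: "0 < r \<Longrightarrow> finite (carrier (grp r))"
  by (simp add: carrier_grp_nf finite_nforms)

lemma basis_expansion_iff:
  assumes "0 < r"
  shows "basis_expansion r h c \<longleftrightarrow> c \<in> carrier (grp r) \<rightarrow> coef_ring r \<and>
    h = hecke_proj r (\<Sum>w\<in>carrier (grp r). free_const (c w) * free_word (rep r w))"
proof (cases "c \<in> carrier (grp r) \<rightarrow> coef_ring r")
  case True
  interpret H: ring "hecke r" using assms by (rule ring_hecke)
  have "(\<Oplus>\<^bsub>hecke r\<^esub>w\<in>carrier (grp r). c w \<odot>\<^bsub>hecke r\<^esub> hecke_basis r w) =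
      (\<Oplus>\<^bsub>hecke r\<^esub>w\<in>carrier (grp r). hecke_proj r (free_const (c w) * free_word (rep r w)))"
    using True assms
    by (intro H.finsum_cong') (auto simp: hecke_basis_def hecke_word_proj hecke_smult Pi_iff)
  also have "\<dots> = hecke_proj r (\<Sum>w\<in>carrier (grp r). free_const (c w) * free_word (rep r w))"
    using True assms by (intro hecke_finsum) (auto simp: finite_carrier_grp Pi_iff)
  finally show ?thesis using True by (simp add: basis_expansion_def)
qed (simp add: basis_expansion_def)

lemma val_basis_expansion:
  assumes "2 \<le> r" "recurrent r u" "f \<in> carrier (free_alg r)" "basis_expansion r (hecke_proj r f) c"
  shows "val u f = (\<Sum>x\<in>nforms r. c (nf_class r x) * val u (free_word (nf_word x)))"
proof -
  have r: "0 < r" using assms by simp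
  have c: "c \<in> carrier (grp r) \<rightarrow> coef_ring r"
    and f: "hecke_proj r f = hecke_proj r (\<Sum>w\<in>carrier (grp r). free_const (c w) * free_word (rep r w))"
    using assms(4) by (simp_all add: basis_expansion_iff[OF r])
  have "val u f = val u (\<Sum>w\<in>carrier (grp r). free_const (c w) * free_word (rep r w))"
    using c r by (intro val_hecke_cong[OF assms(1,2) f] free_alg_sum free_alg_mult assms(3)) (auto simp: Pi_iff)
  also have "\<dots> = (\<Sum>x\<in>nforms r. c (nf_class r x) * val u (free_word (rep r (nf_class r x))))"
    by (simp add: val_sum val_const carrier_grp_nf[OF r] sum.reindex[OF inj_nf_class])
  finally show ?thesis by (simp add: basis_word_nf_class)
qed

lemma expansion_coeff_True:
  assumes "2 \<le> r" "x < r" "y < r" "f \<in> carrier (free_alg r)" "basis_expansion r (hecke_proj r f) c"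
  shows "c (nf_class r (True, x, y)) = val (delta r (True, x, y)) f"
proof -
  have "val (delta r (True, x, y)) (free_word (nf_word z)) = (if z = (True, x, y) then 1 else 0)"
    if "z \<in> nforms r" for z
    using that assms(1-3) by (cases z) (auto simp: val_nf_word delta_nf simp del: nf_word.simps)
  then have "val (delta r (True, x, y)) f =
      (\<Sum>z\<in>nforms r. if z = (True, x, y) then c (nf_class r z) else 0)"
    using assms by (subst val_basis_expansion[OF assms(1) _ assms(4,5)])
      (auto intro!: recurrent_delta sum.cong)
  then show ?thesis using assms by (simp add: finite_nforms)
qed

text \<open>The basis element t^x is t^x s t^0 s - xi_s t^x s t^0, so the form belonging to (False,
  x, 0) also sees the coefficient of t^x. The pairing of forms and basis elements has no other
  off-diagonal entry.\<close>

lemma expansion_coeff_False: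
  assumes "2 \<le> r" "x < r" "y < r" "f \<in> carrier (free_alg r)" "basis_expansion r (hecke_proj r f) c"
  shows "c (nf_class r (False, x, y)) =
    val (delta r (False, x, y)) f + (if y = 0 then xi_s * c (nf_class r (True, x, y)) else 0)"
proof -
  have "val (delta r (False, x, y)) (free_word (nf_word z)) =
      (if z = (False, x, y) then 1 else 0) - (if z = (True, x, y) then if y = 0 then xi_s else 0 else 0)"
    if "z \<in> nforms r" for z
    using that assms(1-3) by (cases z) (auto simp: val_nf_word delta_nf simp del: nf_word.simps)
  then have "val (delta r (False, x, y)) f =
      (\<Sum>z\<in>nforms r. (if z = (False, x, y) then c (nf_class r z) else 0) -
        (if z = (True, x, y) then c (nf_class r z) * (if y = 0 then xi_s else 0) else 0))"
    using assms by (subst val_basis_expansion[OF assms(1) _ assms(4,5)])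
      (auto intro!: recurrent_delta sum.cong)
  then show ?thesis using assms by (simp add: finite_nforms sum_subtractf)
qed

text \<open>The forms \<open>delta\<close> determine the coefficients of an expansion but do not
  produce one, whereas an arrow requires that one exists.\<close>

definition expandable :: "nat \<Rightarrow> free \<Rightarrow> bool" where
  "expandable r f \<longleftrightarrow> (\<exists>c. basis_expansion r (hecke_proj r f) c)"

lemma expandable_cong: "hecke_proj r f = hecke_proj r g \<Longrightarrow> expandable r f \<Longrightarrow> expandable r g"
  by (simp add: expandable_def)

lemma expandable_nf_word:
  assumes "x \<in> nforms r" shows "expandable r (free_word (nf_word x))"
proof -
  have r: "0 < r" using assms by (auto simp: nforms_def)
  define c where "c w = (if w = nf_class r x then 1 else 0 :: coef)" for w
  have "(\<Sum>w\<in>carrier (grp r). free_const (c w) * free_word (rep r w)) =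
      (\<Sum>w\<in>carrier (grp r). if w = nf_class r x then free_word (rep r w) else 0)"
    by (intro sum.cong) (auto simp: c_def)
  also have "\<dots> = free_word (nf_word x)"
    using assms by (simp add: finite_carrier_grp[OF r]) (simp add: carrier_grp_nf[OF r] basis_word_nf_class)
  finally have "basis_expansion r (hecke_proj r (free_word (nf_word x))) c"
    by (auto simp: basis_expansion_iff[OF r] c_def)
  then show ?thesis by (auto simp: expandable_def)
qed

lemma expandable_add:
  assumes "0 < r" "f \<in> carrier (free_alg r)" "g \<in> carrier (free_alg r)"
    "expandable r f" "expandable r g"
  shows "expandable r (f + g)"
proof -
  obtain c d where c: "basis_expansion r (hecke_proj r f) c" and d: "basis_expansion r (hecke_proj r g) d"
    using assms by (auto simp: expandable_def)
  let ?F = "\<lambda>c. \<Sum>w\<in>carrier (grp r). free_const (c w) * free_word (rep r w)"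
  have F: "?F c \<in> carrier (free_alg r)" if "c \<in> carrier (grp r) \<rightarrow> coef_ring r" for c
    using that assms(1) by (intro free_alg_sum) (auto simp: Pi_iff)
  have "hecke_proj r (f + g) = hecke_proj r (?F c + ?F d)"
    using c d assms F by (intro hecke_proj_cong_add) (auto simp: basis_expansion_iff)
  also have "?F c + ?F d = ?F (\<lambda>w. c w + d w)"
    by (simp add: free_const_add distrib_right sum.distrib)
  finally have "basis_expansion r (hecke_proj r (f + g)) (\<lambda>w. c w + d w)"
    using c d assms(1) by (auto simp: basis_expansion_iff Pi_iff)
  then show ?thesis by (auto simp: expandable_def)
qed

lemma expandable_const:
  assumes "0 < r" "f \<in> carrier (free_alg r)" "k \<in> coef_ring r" "expandable r f"
  shows "expandable r (free_const k * f)"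
proof -
  obtain c where c: "basis_expansion r (hecke_proj r f) c"
    using assms by (auto simp: expandable_def)
  let ?F = "\<lambda>c. \<Sum>w\<in>carrier (grp r). free_const (c w) * free_word (rep r w)"
  have F: "?F c \<in> carrier (free_alg r)"
    using c assms(1) by (intro free_alg_sum) (auto simp: basis_expansion_iff Pi_iff)
  have "hecke_proj r (free_const k * f) = hecke_proj r (free_const k * ?F c)"
    using c assms F by (intro hecke_proj_cong_mult) (auto simp: basis_expansion_iff)
  also have "free_const k * ?F c = ?F (\<lambda>w. k * c w)"
    by (simp add: free_const_mult mult.assoc sum_distrib_left)
  finally have "basis_expansion r (hecke_proj r (free_const k * f)) (\<lambda>w. k * c w)"
    using c assms(1,3) by (auto simp: basis_expansion_iff Pi_iff)
  then show ?thesis by (auto simp: expandable_def)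
qed

lemma expandable_sum:
  assumes "0 < r" "\<And>i. i \<in> I \<Longrightarrow> f i \<in> carrier (free_alg r) \<and> expandable r (f i)"
  shows "expandable r (sum f I)"
proof -
  have "basis_expansion r (hecke_proj r 0) (\<lambda>w. 0)"
    using assms(1) by (simp add: basis_expansion_iff)
  then have "expandable r 0" by (auto simp: expandable_def)
  then show ?thesis
    using assms by (induction I rule: infinite_finite_induct) (auto intro!: expandable_add)
qed

lemma expandable_tst:
  assumes "0 < r"
  shows "expandable r (free_gen Gt ^ a * free_gen Gs * free_gen Gt ^ b)"
proof -
  let ?S = "free_gen Gs" and ?T = "free_gen Gt"
  let ?red = "\<lambda>n. \<Sum>x<r. free_const (tcoef r x n) * ?T ^ x"
  have c: "?red n \<in> carrier (free_alg r)" for n by (intro free_alg_sum) auto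
  have red: "hecke_proj r (?T ^ n) = hecke_proj r (?red n)" for n
    using hecke_tpow_reduce[OF assms] assms c by (simp add: hecke_proj_eq_iff)
  have "hecke_proj r (?red a * ?S * ?red b) = hecke_proj r (?T ^ a * ?S * ?T ^ b)"
    using assms c by (intro hecke_proj_cong_mult red[symmetric] refl) auto
  then show ?thesis
  proof (rule expandable_cong)
    have "?red a * ?S * ?red b =
        (\<Sum>x<r. \<Sum>y<r. free_const (tcoef r x a) * (free_const (tcoef r y b) * (?T ^ x * ?S * ?T ^ y)))"
      unfolding sum_distrib_right[of _ _ ?S] sum_product
    proof (intro sum.cong refl)
      fix x y
      have "?T ^ x * ?S * free_const (tcoef r y b) = free_const (tcoef r y b) * (?T ^ x * ?S)"
        by (rule free_const_commute[symmetric])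
      then show "free_const (tcoef r x a) * ?T ^ x * ?S * (free_const (tcoef r y b) * ?T ^ y) =
          free_const (tcoef r x a) * (free_const (tcoef r y b) * (?T ^ x * ?S * ?T ^ y))"
        by (simp add: mult.assoc) (simp flip: mult.assoc)
    qed simp_all
    moreover have "expandable r (\<Sum>x<r. \<Sum>y<r. free_const (tcoef r x a) * (free_const (tcoef r y b) * (?T ^ x * ?S * ?T ^ y)))"
    proof -
      have "expandable r (?T ^ x * ?S * ?T ^ y)" if "x < r" "y < r" for x y
        using that expandable_nf_word[of "(False, x, y)" r]
        by (simp add: free_word_append free_word_Cons free_word_tpow mult.assoc)
      then show ?thesis
        using assms by (auto intro!: expandable_sum expandable_const free_alg_sum free_alg_mult)
    qed
    ultimately show "expandable r (?red a * ?S * ?red b)" by (simp only:)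
  qed
qed

lemma expandable_s_tst:
  assumes "0 < b" "a < r" "b < r"
  shows "expandable r (free_gen Gs * (free_gen Gt ^ b * free_gen Gs * free_gen Gt ^ a))"
proof -
  let ?S = "free_gen Gs" and ?T = "free_gen Gt"
  have r: "0 < r" using assms by simp
  \<comment> \<open>The minus sign is written as a scalar, so that closure of
    \<open>expandable\<close> under sums and scalars covers the correction sum.\<close>
  let ?g = "\<lambda>i. ?T ^ (b + a - i) * ?S * ?T ^ i + free_const (- 1) * (?T ^ i * ?S * ?T ^ (b + a - i))"
  have g: "?g i = ?T ^ (b + a - i) * ?S * ?T ^ i - ?T ^ i * ?S * ?T ^ (b + a - i)" for i
    by (simp add: free_const_def single_uminus)
  let ?f = "?T ^ a * ?S * ?T ^ b * ?S + free_const xi_s * (\<Sum>i = 1..a. ?g i)"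
  have f: "?f \<in> carrier (free_alg r)"
    by (intro free_alg_add free_alg_mult free_alg_sum free_alg_const) auto
  have "?S * (?T ^ b * ?S * ?T ^ a) - ?f \<in> hecke_ideal r"
    unfolding g using hecke_sts_tpow[OF r, of b a] by (simp add: algebra_simps)
  then have "hecke_proj r ?f = hecke_proj r (?S * (?T ^ b * ?S * ?T ^ a))"
    using f r by (simp add: hecke_proj_eq_iff[symmetric])
  moreover have "expandable r ?f"
  proof (intro expandable_add expandable_const expandable_sum conjI expandable_tst r)
    show "expandable r (?T ^ a * ?S * ?T ^ b * ?S)"
      using expandable_nf_word[of "(True, a, b)" r] assms
      by (simp add: free_word_append free_word_Cons free_word_Nil free_word_tpow mult.assoc)
  qed (auto intro!: free_alg_add free_alg_mult free_alg_sum)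
  ultimately show ?thesis by (rule expandable_cong)
qed

subsection \<open>The arrows\<close>

text \<open>The quadratic relation makes R + R T_s closed under products.\<close>

lemma hecke_parabolic_s:
  assumes "0 < r" "x \<in> hecke_parabolic r {Gs}"
  shows "\<exists>c\<in>coef_ring r. \<exists>k\<in>coef_ring r. x = hecke_proj r (free_const c + free_const k * free_gen Gs)"
proof -
  let ?p = "\<lambda>c k. free_const c + free_const k * free_gen Gs"
  have p: "?p c k \<in> carrier (free_alg r)" if "c \<in> coef_ring r" "k \<in> coef_ring r" for c k
    using that by (intro free_alg_add free_alg_mult) auto
  have "x \<in> generate_ring (hecke r)
      ((\<lambda>c. c \<odot>\<^bsub>hecke r\<^esub> \<one>\<^bsub>hecke r\<^esub>) ` coef_ring r \<union> hecke_gen r ` {Gs})"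
    using assms(2) by (simp add: hecke_parabolic_def)
  then show ?thesis
  proof (induction rule: generate_ring.induct)
    case one
    show ?case by (intro bexI[of _ 1] bexI[of _ 0]) (simp_all add: hecke_one assms(1))
  next
    case (incl h)
    then consider c where "c \<in> coef_ring r" "h = c \<odot>\<^bsub>hecke r\<^esub> \<one>\<^bsub>hecke r\<^esub>"
      | "h = hecke_gen r Gs" by auto
    then show ?case
    proof cases
      case (1 c)
      then show ?thesis
        by (intro bexI[of _ c] bexI[of _ 0]) (simp_all add: hecke_one hecke_smult assms(1))
    next
      case 2
      then show ?thesis by (intro bexI[of _ 0] bexI[of _ 1]) (simp_all add: hecke_gen_def)
    qed
  next
    case (a_inv h)
    then obtain c k where ck: "c \<in> coef_ring r" "k \<in> coef_ring r" "h = hecke_proj r (?p c k)" by blast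
    have "- ?p c k = ?p (- c) (- k)" by (simp add: free_const_def single_uminus)
    then show ?case
      using ck p[OF ck(1,2)] by (intro bexI[of _ "- c"] bexI[of _ "- k"]) (simp_all add: hecke_uminus assms(1))
  next
    case (eng_add h h')
    then obtain c k c' k' where ck: "c \<in> coef_ring r" "k \<in> coef_ring r" "h = hecke_proj r (?p c k)"
      "c' \<in> coef_ring r" "k' \<in> coef_ring r" "h' = hecke_proj r (?p c' k')" by blast
    have "?p c k + ?p c' k' = ?p (c + c') (k + k')" by (simp add: free_const_add algebra_simps)
    then show ?case
      using ck p[OF ck(1,2)] p[OF ck(4,5)]
      by (intro bexI[of _ "c + c'"] bexI[of _ "k + k'"]) (simp_all add: hecke_add assms(1))
  next
    case (eng_mult h h')
    then obtain c k c' k' where ck: "c \<in> coef_ring r" "k \<in> coef_ring r" "h = hecke_proj r (?p c k)"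
      "c' \<in> coef_ring r" "k' \<in> coef_ring r" "h' = hecke_proj r (?p c' k')" by blast
    let ?S = "free_gen Gs"
    \<comment> \<open>The product (c + k S)(c' + k' S) with S^2 replaced by 1 + xi_s S.\<close>
    let ?q = "?p (c * c' + k * k') (c * k' + k * c' + k * k' * xi_s)"
    have "?S * ?S - (1 + free_const xi_s * ?S) \<in> hecke_ideal r"
      using relator_in_hecke_ideal[OF assms(1)] by (auto simp: hecke_relators_def Let_def power2_eq_square)
    then have "free_const (k * k') * (?S * ?S - (1 + free_const xi_s * ?S)) \<in> hecke_ideal r"
      using ck assms(1) by (intro hecke_ideal_mult_left) simp_all
    also have "free_const (k * k') * (?S * ?S - (1 + free_const xi_s * ?S)) = ?p c k * ?p c' k' - ?q"
    proof -
      have comm: "?S * free_const d = free_const d * ?S" "?S * (free_const d * z) = free_const d * (?S * z)" for d z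
        using free_const_commute[of d ?S] by (simp_all flip: mult.assoc)
      have const: "free_const d * free_const e = free_const (d * e)"
        "free_const d * (free_const e * z) = free_const (d * e) * z" for d e z
        by (simp_all add: free_const_mult mult.assoc)
      show ?thesis
        by (simp add: free_const_add algebra_simps comm const)
    qed
    finally have "hecke_proj r (?p c k * ?p c' k') = hecke_proj r ?q"
      using ck p assms(1) by (subst hecke_proj_eq_iff) (simp_all del: minus_diff_eq)
    then show ?case
      using ck p[OF ck(1,2)] p[OF ck(4,5)]
      by (intro bexI[of _ "c * c' + k * k'"] bexI[of _ "c * k' + k * c' + k * k' * xi_s"])
        (simp_all add: hecke_mult assms(1))
  qed
qed

text \<open>By \<open>hecke_parabolic_s\<close> the bimodule is spanned over R by the four products
  of D with 1 or S on each side, so it suffices to test a linear form on these.\<close>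

lemma hecke_bimodule_val:
  assumes r: "0 < r" and D: "D \<in> carrier (free_alg r)" "hecke_basis r d = hecke_proj r D"
    and val: "val u D = 0" "val u (D * free_gen Gs) = 0" "val u (free_gen Gs * D) = 0"
      "val u (free_gen Gs * (D * free_gen Gs)) = 0"
    and h: "h \<in> hecke_bimodule r {Gs} d"
  shows "\<exists>f\<in>carrier (free_alg r). h = hecke_proj r f \<and> val u f = 0"
proof -
  let ?S = "free_gen Gs"
  let ?p = "\<lambda>c k. free_const c + free_const k * ?S"
  have *: "\<exists>f\<in>carrier (free_alg r). g = hecke_proj r f \<and> val u f = 0"
    if mem: "g \<in> {x \<otimes>\<^bsub>hecke r\<^esub> hecke_basis r d \<otimes>\<^bsub>hecke r\<^esub> y | x y.
        x \<in> hecke_parabolic r {Gs} \<and> y \<in> hecke_parabolic r {Gs}}" for g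
  proof -
    obtain x y where x: "x \<in> hecke_parabolic r {Gs}" and y: "y \<in> hecke_parabolic r {Gs}"
      and xy: "g = x \<otimes>\<^bsub>hecke r\<^esub> hecke_basis r d \<otimes>\<^bsub>hecke r\<^esub> y"
      using mem by blast
    obtain c k where ck: "c \<in> coef_ring r" "k \<in> coef_ring r" "x = hecke_proj r (?p c k)"
      using hecke_parabolic_s[OF r x] by blast
    obtain c' k' where ck': "c' \<in> coef_ring r" "k' \<in> coef_ring r" "y = hecke_proj r (?p c' k')"
      using hecke_parabolic_s[OF r y] by blast
    have g: "g = hecke_proj r (?p c k) \<otimes>\<^bsub>hecke r\<^esub> hecke_proj r D \<otimes>\<^bsub>hecke r\<^esub> hecke_proj r (?p c' k')"
      using xy ck(3) ck'(3) D(2) by simp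
    have p: "?p c k \<in> carrier (free_alg r)" "?p c' k' \<in> carrier (free_alg r)"
      using ck ck' by (auto intro!: free_alg_add free_alg_mult)
    have comm: "z * free_const d = free_const d * z" "z * (free_const d * w) = free_const d * (z * w)" for z w d
      using free_const_commute[of d z] by (simp_all flip: mult.assoc)
    have "?p c k * D * ?p c' k' = free_const c * (free_const c' * D) + free_const c * (free_const k' * (D * ?S))
        + (free_const k * (free_const c' * (?S * D)) + free_const k * (free_const k' * (?S * (D * ?S))))"
      by (simp add: distrib_left distrib_right mult.assoc comm(1)[of _ c'] comm(2)[of _ k'] comm(2)[of _ c'] add.assoc)
    then have "val u (?p c k * D * ?p c' k') = 0"
      by (simp only: val_add val_const val) simp
    then show ?thesis
      using g p D r by (intro bexI[of _ "?p c k * D * ?p c' k'"]) (simp_all add: hecke_mult)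
  qed
  from h show ?thesis
    unfolding hecke_bimodule_def
  proof (induction rule: generate.induct)
    case one
    have "val u 0 = 0" using val_const[of u 0 0] by simp
    then show ?case by (intro bexI[of _ 0]) (simp_all add: hecke_zero r)
  next
    case (incl g)
    then show ?case by (rule *)
  next
    case (inv g)
    then obtain f where "f \<in> carrier (free_alg r)" "g = hecke_proj r f" "val u f = 0" using * by blast
    then show ?case
      by (intro bexI[of _ "- f"]) (simp_all add: hecke_uminus r val_uminus flip: a_inv_def)
  next
    case (eng g g')
    then obtain f f' where "f \<in> carrier (free_alg r)" "g = hecke_proj r f" "val u f = 0"
      "f' \<in> carrier (free_alg r)" "g' = hecke_proj r f'" "val u f' = 0" by blast
    then show ?case by (intro bexI[of _ "f + f'"]) (simp_all add: hecke_add r val_add)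
  qed
qed

text \<open>The coefficient of t^x s t^y in the reduced correction sum of s t^a s t^b, without the
  factor xi_s.\<close>

definition kappa :: "nat \<Rightarrow> nat \<Rightarrow> nat \<Rightarrow> nat \<Rightarrow> nat \<Rightarrow> coef" where
  "kappa r a b x y = diag (\<lambda>i j. tcoef r x i * tcoef r y j) a b"

lemma diag_delta: "diag (delta r (e', x, y) e) a b = (if e = e' then kappa r a b x y else 0)"
proof -
  have "delta r (e', x, y) e = (\<lambda>i j. if e = e' then tcoef r x i * tcoef r y j else 0)"
    by (simp add: delta_def fun_eq_iff)
  then show ?thesis by (cases "e = e'") (simp_all add: kappa_def, simp add: diag_def)
qed

text \<open>Since i <= b < r, the power t^i in each term is already reduced. Hence only i = y in the
  first half and i = x in the second contribute, and only t^(a+b-i) may need reduction.\<close>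

lemma kappa_eq:
  assumes "b < r" "x < r" "y < r"
  shows "kappa r a b x y = (if 1 \<le> y \<and> y \<le> b then tcoef r x (a + b - y) else 0)
    - (if 1 \<le> x \<and> x \<le> b then tcoef r y (a + b - x) else 0)"
proof -
  have "kappa r a b x y = (\<Sum>i = 1..b. (if i = y then tcoef r x (a + b - i) else 0)
      - (if i = x then tcoef r y (a + b - i) else 0))"
    unfolding kappa_def diag_def using assms by (intro sum.cong) (auto simp: tcoef_less)
  then show ?thesis by (simp add: sum_subtractf)
qed

text \<open>The pairs $y < x$ for which $t^x s t^y$ occurs in $\tilde T_s \tilde T_{t^a s t^b}$; here \<open>a + b - r\<close> is truncated.\<close>

definition arrow :: "nat \<Rightarrow> nat \<Rightarrow> nat \<Rightarrow> nat \<Rightarrow> nat \<Rightarrow> bool" where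
  "arrow r a b x y \<longleftrightarrow> a + b - r < y \<and> y \<le> b \<and> x = a + b - y
    \<or> y = 0 \<and> 1 \<le> x \<and> x \<le> a + b - r
    \<or> 1 \<le> y \<and> y \<le> a + b - r"

lemma arrow_iff_kappa:
  assumes "1 \<le> b" "b \<le> a" "a < r" "y < x" "x < r"
  shows "arrow r a b x y \<Longrightarrow> aug (kappa r a b x y) \<noteq> 0"
    and "\<not> arrow r a b x y \<Longrightarrow> kappa r a b x y = 0"
proof -
  have k: "kappa r a b x y = (if 1 \<le> y \<and> y \<le> b then tcoef r x (a + b - y) else 0)
    - (if 1 \<le> x \<and> x \<le> b then tcoef r y (a + b - x) else 0)"
    using assms by (intro kappa_eq) auto
  show "aug (kappa r a b x y) \<noteq> 0" if "arrow r a b x y"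
    using that unfolding arrow_def
  proof (elim disjE conjE)
    assume y: "a + b - r < y" "y \<le> b" "x = a + b - y"
    \<comment> \<open>Here x >= a >= b, so x <= b would give a = b = x and then y = x. The negative
      term is therefore absent, and the positive one is 1.\<close>
    then have "\<not> x \<le> b" "1 \<le> y" "x < r" "a + b - y = x" using assms by auto
    then show ?thesis using y(2) unfolding k by (simp add: tcoef_less)
  next
    assume y: "y = 0" and x: "1 \<le> x" "x \<le> a + b - r"
    then have "x \<le> b" "r \<le> a + b - x" using assms by auto
    then show ?thesis unfolding k using x y assms aug_tcoef_pos[of r 0 "a + b - x"] by (simp add: aug_uminus)
  next
    assume y: "1 \<le> y" "y \<le> a + b - r"
    then have yb: "y \<le> b" and ry: "r \<le> a + b - y" using assms by auto
    show ?thesis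
    proof (cases "x \<le> b")
      case False
      then show ?thesis using y yb ry assms aug_tcoef_pos[of r x "a + b - y"] by (simp add: k)
    next
      case xb: True
      show ?thesis
      proof (cases "x \<le> a + b - r")
        case True
        \<comment> \<open>Both powers need reduction. The larger index x comes with the larger
          exponent a + b - y, so the two terms cannot cancel.\<close>
        then have "aug (tcoef r y (a + b - x)) < aug (tcoef r x (a + b - y))"
          using y yb xb ry assms by (intro aug_tcoef_less) auto
        then show ?thesis using y yb xb assms by (simp add: k aug_diff)
      next
        case False
        \<comment> \<open>The second power is already reduced, and a + b - x = y would give x = a +
          b - y >= r; so the negative term is 0.\<close>
        then have "a + b - x < r" "y \<noteq> a + b - x" using y yb xb assms by auto
        then show ?thesis
          using y yb xb ry assms aug_tcoef_pos[of r x "a + b - y"] by (simp add: k aug_diff tcoef_less)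
      qed
    qed
  qed
  show "kappa r a b x y = 0" if na: "\<not> arrow r a b x y"
  proof -
    have n: "\<not> (1 \<le> y \<and> y \<le> a + b - r)" "\<not> (y = 0 \<and> 1 \<le> x \<and> x \<le> a + b - r)"
      "\<not> (a + b - r < y \<and> y \<le> b \<and> x = a + b - y)"
      using na unfolding arrow_def by blast+
    have y0: "(if 1 \<le> y \<and> y \<le> b then tcoef r x (a + b - y) else 0) = 0"
    proof (cases "1 \<le> y \<and> y \<le> b")
      case True
      then have "a + b - y < r" "x \<noteq> a + b - y" using n assms by auto
      then show ?thesis using assms by (simp add: tcoef_less)
    next
      case False
      then show ?thesis by (rule if_not_P)
    qed
    have x0: "(if 1 \<le> x \<and> x \<le> b then tcoef r y (a + b - x) else 0) = 0"
    proof (cases "1 \<le> x \<and> x \<le> b")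
      case True
      then have "a + b - x < r" "y \<noteq> a + b - x" using n assms by auto
      then show ?thesis using assms by (simp add: tcoef_less)
    next
      case False
      then show ?thesis by (rule if_not_P)
    qed
    show ?thesis unfolding k y0 x0 by simp
  qed
qed

lemma kappa_swap:
  assumes "b < r" "x < r" "y < r" shows "kappa r a b y x = - kappa r a b x y"
  using assms by (simp add: kappa_eq)

lemma hecke_basis_free_word:
  assumes "z \<in> nforms r" shows "hecke_basis r (nf_class r z) = hecke_proj r (free_word (nf_word z))"
proof -
  have "0 < r" using assms by (auto simp: nforms_def)
  then show ?thesis using assms by (simp add: hecke_basis_nf_class hecke_word_proj)
qed

text \<open>Outside the pairs (a, b) and (b, a) the coordinate forms vanish on D and DS. On SD and
  SDS only their \<open>diag\<close> part could survive, and it is a multiple of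
  \<open>kappa\<close>.\<close>

lemma kappa_nonzero_if_coeff:
  assumes r: "2 \<le> r" and ab: "b \<le> a" "a < r" and xy: "x < r" "y < r"
    and h: "h \<in> hecke_bimodule r {Gs} (nf_class r (b = 0, a, b))"
    and c: "basis_expansion r h c" "c (nf_class r (e, x, y)) \<noteq> 0"
    and ne: "(x, y) \<noteq> (a, b)" "(x, y) \<noteq> (b, a)"
  shows "kappa r a b x y \<noteq> 0"
proof
  assume k: "kappa r a b x y = 0"
  let ?D = "free_word (nf_word (b = 0, a, b))"
  have b: "b < r" "0 < r" using ab r by auto
  have D: "val u ?D = (if b = 0 then u True a 0 - xi_s * u False a 0 else u False a b)"
    "val u (?D * free_gen Gs) = (if b = 0 then u False a 0 else u True a b)" for u
    using val_nf_word[of u "b = 0" a b] val_tst[of u a 0] val_tsts[of u a b]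
    by (auto simp: free_word_append free_word_Cons free_word_Nil free_word_tpow mult.assoc)
  have coeff: "val (delta r (e', x, y)) ?D = 0" "val (delta r (e', x, y)) (?D * free_gen Gs) = 0"
    "val (delta r (e', x, y)) (free_gen Gs * ?D) = 0"
    "val (delta r (e', x, y)) (free_gen Gs * (?D * free_gen Gs)) = 0" for e'
    unfolding val_gen_left D using b ab xy ne k by (auto simp: delta_nf diag_delta)
  have "c (nf_class r (e', x, y)) = (if \<not> e' \<and> y = 0 then xi_s * c (nf_class r (True, x, y)) else 0)" for e'
  proof -
    have "\<exists>f\<in>carrier (free_alg r). h = hecke_proj r f \<and> val (delta r (e', x, y)) f = 0"
      using b ab by (intro hecke_bimodule_val[OF b(2) _ hecke_basis_free_word coeff h]) auto
    then obtain f where f: "f \<in> carrier (free_alg r)" "h = hecke_proj r f" "val (delta r (e', x, y)) f = 0"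
      by blast
    then show ?thesis
      using expansion_coeff_True[OF r xy f(1), of c] expansion_coeff_False[OF r xy f(1), of c] c(1)
      by (cases e') auto
  qed
  \<comment> \<open>The coefficient with e = True vanishes outright, and with it the extra term in
    the one with e = False.\<close>
  from this[of True] this[of e] c(2) show False by (auto split: if_splits)
qed

text \<open>The witness is SD itself: the form of (False, x, y) takes the value xi_s times
  \<open>kappa\<close> on it, which \<open>aug\<close> shows to be non-zero.\<close>

lemma coeff_if_kappa_nonzero:
  assumes r: "2 \<le> r" and ab: "1 \<le> b" "b \<le> a" "a < r" and xy: "x < r" "y < r"
    and k: "aug (kappa r a b x y) \<noteq> 0"
  obtains h c e where "h \<in> hecke_bimodule r {Gs} (nf_class r (False, a, b))"
    "basis_expansion r h c" "c (nf_class r (e, x, y)) \<noteq> 0"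
proof -
  have r0: "0 < r" and b: "b < r" using r ab by auto
  let ?D = "free_gen Gt ^ a * free_gen Gs * free_gen Gt ^ b" and ?S = "free_gen Gs"
  have D: "?D \<in> carrier (free_alg r)" by simp
  have basis: "hecke_basis r (nf_class r (False, a, b)) = hecke_proj r ?D"
    using ab b by (subst hecke_basis_free_word)
      (simp_all add: free_word_append free_word_Cons free_word_tpow mult.assoc)
  have "hecke_gen r Gs \<in> hecke_parabolic r {Gs}" "\<one>\<^bsub>hecke r\<^esub> \<in> hecke_parabolic r {Gs}"
    unfolding hecke_parabolic_def by (auto intro: generate_ring.intros)
  then have "hecke_gen r Gs \<otimes>\<^bsub>hecke r\<^esub> hecke_basis r (nf_class r (False, a, b)) \<otimes>\<^bsub>hecke r\<^esub> \<one>\<^bsub>hecke r\<^esub>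
      \<in> hecke_bimodule r {Gs} (nf_class r (False, a, b))"
    unfolding hecke_bimodule_def by (intro generate.incl) blast
  moreover have "hecke_gen r Gs \<otimes>\<^bsub>hecke r\<^esub> hecke_basis r (nf_class r (False, a, b)) \<otimes>\<^bsub>hecke r\<^esub> \<one>\<^bsub>hecke r\<^esub>
      = hecke_proj r (?S * ?D)"
    using r0 D by (simp add: hecke_gen_def basis hecke_mult hecke_one)
  ultimately have h: "hecke_proj r (?S * ?D) \<in> hecke_bimodule r {Gs} (nf_class r (False, a, b))" by simp
  obtain c where c: "basis_expansion r (hecke_proj r (?S * ?D)) c"
    using expandable_s_tst[of a b r] ab b by (auto simp: expandable_def)
  \<comment> \<open>For y = 0 that form mixes the coefficients of t^x and t^x s, so only one of the
    two is known to be non-zero. Both lie in the same double coset.\<close>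
  have "\<exists>e. c (nf_class r (e, x, y)) \<noteq> 0"
  proof (rule ccontr)
    assume "\<not> (\<exists>e. c (nf_class r (e, x, y)) \<noteq> 0)"
    then have z: "c (nf_class r (e, x, y)) = 0" for e by blast
    have "val (delta r (False, x, y)) (?S * ?D) = 0"
      using expansion_coeff_False[OF r xy _ c] z[of True] z[of False] by (auto split: if_splits)
    moreover have "val (delta r (False, x, y)) (?S * ?D) = xi_s * kappa r a b x y"
      unfolding val_gen_left val_tst by (simp add: diag_delta) (simp add: delta_def)
    ultimately have "aug (xi_s * kappa r a b x y) = 0" by simp
    then show False using k by (simp add: aug_mult)
  qed
  then show thesis using that h c by blast
qed

section \<open>Double cosets as unordered pairs, and the arrows of the graph\<close>

abbreviation dcoset :: "nat \<Rightarrow> nat \<Rightarrow> nat \<Rightarrow> gen list set set" where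
  "dcoset r a b \<equiv> double_coset r {Gs} (nf_class r (False, a, b))"

lemma double_coset_nf_class: "double_coset r {Gs} (nf_class r (e, a, b)) = dcoset r a b"
  by (simp only: double_coset_nf)

lemma dcoset_commute: "dcoset r a b = dcoset r b a"
  unfolding double_coset_nf by blast

lemma coset_of_tst: "coset_of r (tpow a @ [Gs] @ tpow b) = dcoset r a b"
  by (simp add: coset_of_def nf_class_def)

lemma coset_of_t: "coset_of r (tpow a) = dcoset r a 0"
  using double_coset_nf_class[of r True a 0] by (simp add: coset_of_def nf_class_def)

text \<open>The flag b = 0 selects t^a for b = 0 and t^a s t^b otherwise, which merges the three
  kinds of representatives into one family.\<close>

lemma s_reps_eq:
  assumes "0 < r" shows "s_reps r = {nf_class r (b = 0, a, b) | a b. b \<le> a \<and> a < r}" (is "_ = ?R")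
proof
  have w: "nf_class r ((0::nat) = 0, a, 0) = grp_class r (tpow a)"
    "1 \<le> b \<Longrightarrow> nf_class r (b = 0, a, b) = grp_class r (tpow a @ [Gs] @ tpow b)" for a b
    by (simp_all add: nf_class_def)
  show "?R \<subseteq> s_reps r"
  proof
    fix d assume "d \<in> ?R"
    then obtain a b where d: "d = nf_class r (b = 0, a, b)" "b \<le> a" "a \<le> r - 1" using assms by auto
    consider "b = 0" "a = 0" | "b = 0" "1 \<le> a" | "1 \<le> b" by linarith
    then show "d \<in> s_reps r"
    proof cases
      case 1 then show ?thesis using d by (simp add: s_reps_def nf_class_def)
    next
      case 2 then show ?thesis using d w(1)[of a] unfolding s_reps_def by blast
    next
      case 3 then show ?thesis using d w(2)[of b a] unfolding s_reps_def by blast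
    qed
  qed
  have R: "nf_class r (b = 0, a, b) \<in> ?R" if "b \<le> a" "a \<le> r - 1" for a b
  proof -
    have "a < r" using that assms by auto
    then show ?thesis using that by blast
  qed
  show "s_reps r \<subseteq> ?R"
  proof
    fix d assume "d \<in> s_reps r"
    then consider "d = grp_class r []" | a where "d = grp_class r (tpow a)" "a \<le> r - 1"
      | a b where "d = grp_class r (tpow a @ [Gs] @ tpow b)" "1 \<le> b" "b \<le> a" "a \<le> r - 1"
      unfolding s_reps_def by blast
    then show "d \<in> ?R"
    proof cases
      case 1
      then have eq: "d = nf_class r ((0::nat) = 0, 0, 0)" by (simp add: nf_class_def)
      show ?thesis unfolding eq by (rule R) simp_all
    next
      case (2 a)
      then have eq: "d = nf_class r ((0::nat) = 0, a, 0)" by (simp add: nf_class_def)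
      show ?thesis unfolding eq by (rule R) (use 2 in simp_all)
    next
      case (3 a b)
      then have eq: "d = nf_class r (b = 0, a, b)" by (simp add: nf_class_def)
      show ?thesis unfolding eq by (rule R) (use 3 in simp_all)
    qed
  qed
qed

lemma nontrivial_arrow_iff:
  assumes r: "2 \<le> r" and ne: "A \<noteq> B"
  shows "(A, B) \<in> parcs (double_coset_graph r {Gs} (s_reps r)) \<longleftrightarrow>
    (\<exists>a b x y. A = dcoset r a b \<and> B = dcoset r x y \<and>
      1 \<le> b \<and> b \<le> a \<and> a < r \<and> y < x \<and> x < r \<and> arrow r a b x y)" (is "?L \<longleftrightarrow> ?R")
proof
  have r0: "0 < r" using r by simp
  assume ?L
  then obtain d d' h c w where *: "A = double_coset r {Gs} d" "B = double_coset r {Gs} d'" "d \<in> s_reps r"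
    "d' \<in> carrier (grp r)" "h \<in> hecke_bimodule r {Gs} d" "basis_expansion r h c"
    "w \<in> double_coset r {Gs} d'" "c w \<noteq> 0"
    by (auto simp: double_coset_graph_def)
  obtain a b where d: "d = nf_class r (b = 0, a, b)" "b \<le> a" "a < r"
    using *(3) by (auto simp: s_reps_eq[OF r0])
  obtain e' x' y' where d': "d' = nf_class r (e', x', y')" "x' < r" "y' < r"
    using *(4) by (auto simp: carrier_grp_nf[OF r0] nforms_def)
  obtain e x y where w: "w = nf_class r (e, x, y)" "(x, y) = (x', y') \<or> (x, y) = (y', x')"
    using *(7) unfolding d' double_coset_nf by blast
  have xy: "x < r" "y < r" using w(2) d' by auto
  have A: "A = dcoset r a b" using *(1) d(1) double_coset_nf_class[of r "b = 0" a b] by simp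
  have B: "B = dcoset r x y"
    using *(2) d'(1) w(2) dcoset_commute[of r x y] double_coset_nf_class[of r e' x' y'] by auto
  have xy_ne: "(x, y) \<noteq> (a, b)" "(x, y) \<noteq> (b, a)"
    using ne A B dcoset_commute[of r a b] by auto
  have k: "kappa r a b x y \<noteq> 0"
    using kappa_nonzero_if_coeff[OF r d(2,3) xy _ *(6) _ xy_ne] *(5,8) w(1) d(1) by blast
  \<comment> \<open>The correction sum is empty for b = 0, so no non-trivial arrow leaves the double
    coset of t^a.\<close>
  have b: "1 \<le> b" using k by (cases b) (auto simp: kappa_def)
  have br: "b < r" using d by simp
  \<comment> \<open>The target is an unordered pair and \<open>kappa\<close> is antisymmetric in x
    and y, so y < x may be arranged; the diagonal x = y is excluded because \<open>kappa\<close>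
    vanishes there.\<close>
  consider "y < x" | "x < y" | "x = y" by linarith
  then show ?R
  proof cases
    case 1
    then have "arrow r a b x y" using arrow_iff_kappa(2)[OF b d(2,3) _ xy(1)] k by blast
    then show ?thesis using A B b d xy 1 by blast
  next
    case 2
    have "kappa r a b y x \<noteq> 0" using k kappa_swap[OF br xy, of a] by simp
    then have "arrow r a b y x" using arrow_iff_kappa(2)[OF b d(2,3) 2 xy(2)] by blast
    then show ?thesis using A B b d xy 2 dcoset_commute[of r x y] by blast
  next
    case 3
    have "kappa r a b x y = 0" using kappa_eq[OF br xy(2,2), of a] 3 by simp
    with k show ?thesis by simp
  qed
next
  have r0: "0 < r" using r by simp
  assume ?R
  then obtain a b x y where *: "A = dcoset r a b" "B = dcoset r x y" "1 \<le> b" "b \<le> a" "a < r"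
    "y < x" "x < r" "arrow r a b x y" by blast
  have y: "y < r" using * by simp
  obtain h c e where h: "h \<in> hecke_bimodule r {Gs} (nf_class r (False, a, b))"
    "basis_expansion r h c" "c (nf_class r (e, x, y)) \<noteq> 0"
    using coeff_if_kappa_nonzero[OF r *(3-5,7) y arrow_iff_kappa(1)[OF *(3-8)]] by blast
  have "nf_class r (e, x, y) \<in> dcoset r x y" unfolding double_coset_nf by blast
  then have ex: "\<exists>h \<in> hecke_bimodule r {Gs} (nf_class r (False, a, b)). \<exists>c. basis_expansion r h c \<and>
      (\<exists>w \<in> dcoset r x y. c w \<noteq> 0)"
    using h by blast
  have "nf_class r (b = 0, a, b) \<in> s_reps r"
    unfolding s_reps_eq[OF r0] using *(4,5) by blast
  then have d: "nf_class r (False, a, b) \<in> s_reps r" using *(3) by simp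
  have d': "nf_class r (False, x, y) \<in> carrier (grp r)"
    using *(7) y by (simp add: carrier_grp_nf[OF r0])
  show ?L
    unfolding *(1,2) double_coset_graph_def pair_pre_digraph.simps
    by (rule CollectI, intro exI conjI) (rule HOL.refl, rule d, rule d', rule ex)
qed

theorem proposition4p6:
  fixes r :: nat
  assumes "r \<ge> 2"
  shows "{(A, B). (A, B) \<in> parcs (double_coset_graph r {Gs} (s_reps r)) \<and> A \<noteq> B} =
    ({(coset_of r (tpow a @ [Gs] @ tpow b), coset_of r (tpow (a + b - i) @ [Gs] @ tpow i)) | a b i.
        1 \<le> b \<and> b \<le> a \<and> a \<le> r - 1 \<and> a + b \<le> r \<and> 1 \<le> i \<and> i \<le> b} \<union>
     {(coset_of r (tpow a @ [Gs] @ tpow b), coset_of r (tpow i)) | a b i.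
        1 \<le> b \<and> b \<le> a \<and> a \<le> r - 1 \<and> a + b > r \<and> 1 \<le> i \<and> i \<le> a + b - r} \<union>
     {(coset_of r (tpow a @ [Gs] @ tpow b), coset_of r (tpow x @ [Gs] @ tpow i)) | a b i x.
        1 \<le> b \<and> b \<le> a \<and> a \<le> r - 1 \<and> a + b > r \<and> 1 \<le> i \<and> i \<le> a + b - r \<and>
        i < x \<and> x \<le> r - 1} \<union>
     {(coset_of r (tpow a @ [Gs] @ tpow b), coset_of r (tpow (a + b - i) @ [Gs] @ tpow i)) | a b i.
        1 \<le> b \<and> b \<le> a \<and> a \<le> r - 1 \<and> a + b > r \<and> a + b - r < i \<and> i \<le> b})
    - {(A, B). A = B}"
    (is "?L = ?S1 \<union> ?S2 \<union> ?S3 \<union> ?S4 - ?I")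
proof -
  have le: "m \<le> r - 1 \<longleftrightarrow> m < r" for m using assms by auto
  let ?P = "\<lambda>A B. \<exists>a b x y. A = dcoset r a b \<and> B = dcoset r x y \<and>
      1 \<le> b \<and> b \<le> a \<and> a < r \<and> y < x \<and> x < r \<and> arrow r a b x y"
  have fwd: "(A, B) \<in> ?S1 \<union> ?S2 \<union> ?S3 \<union> ?S4" if P: "?P A B" for A B
  proof -
    obtain a b x y where *: "A = dcoset r a b" "B = dcoset r x y" "1 \<le> b" "b \<le> a" "a < r"
      "y < x" "x < r" "arrow r a b x y" using P by blast
    \<comment> \<open>The first alternative of \<open>arrow\<close> belongs to two families of the
      theorem, according to whether the truncated difference a + b - r is 0.\<close>
    from *(8) consider (1) "a + b - r < y" "y \<le> b" "x = a + b - y" "a + b \<le> r"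
      | (2) "a + b - r < y" "y \<le> b" "x = a + b - y" "r < a + b"
      | (3) "y = 0" "1 \<le> x" "x \<le> a + b - r"
      | (4) "1 \<le> y" "y \<le> a + b - r"
      unfolding arrow_def by linarith
    then show ?thesis
    proof cases
      case 1
      then have "(A, B) \<in> ?S1" unfolding coset_of_tst le using * by force
      then show ?thesis by blast
    next
      case 2
      then have "(A, B) \<in> ?S4" unfolding coset_of_tst le using * by force
      then show ?thesis by blast
    next
      case 3
      then have "r < a + b" by simp
      with 3 have "(A, B) \<in> ?S2" unfolding coset_of_tst coset_of_t le using * by blast
      then show ?thesis by blast
    next
      case 4
      then have "r < a + b" by simp
      with 4 have "(A, B) \<in> ?S3" unfolding coset_of_tst le using * by blast
      then show ?thesis by blast
    qed
  qed
  have bwd: "?P A B" if AB: "(A, B) \<in> ?S1 \<union> ?S2 \<union> ?S3 \<union> ?S4" "A \<noteq> B" for A B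
  proof -
    \<comment> \<open>Conversely these two families merge: for a + b <= r the bound a + b - r < i
      reads 1 <= i.\<close>
    from AB(1) consider (1) a b i where "A = dcoset r a b" "B = dcoset r (a + b - i) i" "1 \<le> b" "b \<le> a" "a < r"
        "a + b - r < i" "i \<le> b"
      | (2) a b i where "A = dcoset r a b" "B = dcoset r i 0" "1 \<le> b" "b \<le> a" "a < r" "1 \<le> i" "i \<le> a + b - r"
      | (3) a b i x where "A = dcoset r a b" "B = dcoset r x i" "1 \<le> b" "b \<le> a" "a < r" "1 \<le> i" "i \<le> a + b - r"
        "i < x" "x < r"
      unfolding coset_of_tst coset_of_t le by fastforce
    then show ?thesis
    proof cases
      case (1 a b i)
      \<comment> \<open>With i <= b <= a, the exponents i and a + b - i can agree only if i = a = b,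
        and that is a loop.\<close>
      have "\<not> (i = a \<and> a = b)" using 1 AB(2) by auto
      then have "i < a + b - i" "a + b - i < r" "arrow r a b (a + b - i) i"
        using 1 unfolding arrow_def by auto
      then show ?thesis using 1 by blast
    next
      case (2 a b i)
      then have "0 < i" "i < r" "arrow r a b i 0" unfolding arrow_def by auto
      then show ?thesis using 2 by blast
    next
      case (3 a b i x)
      then have "arrow r a b x i" unfolding arrow_def by auto
      then show ?thesis using 3 by blast
    qed
  qed
  show ?thesis
  proof (rule Set.set_eqI)
    fix z :: "gen list set set \<times> gen list set set"
    obtain A B where z: "z = (A, B)" by (cases z)
    show "z \<in> ?L \<longleftrightarrow> z \<in> ?S1 \<union> ?S2 \<union> ?S3 \<union> ?S4 - ?I"
    proof (cases "A = B")
      case True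
      then show ?thesis by (simp add: z)
    next
      case False
      have "z \<in> ?L \<longleftrightarrow> ?P A B"
        using nontrivial_arrow_iff[OF assms False] False by (simp add: z)
      also have "\<dots> \<longleftrightarrow> (A, B) \<in> ?S1 \<union> ?S2 \<union> ?S3 \<union> ?S4"
        by (rule iffI) (erule fwd, erule bwd[OF _ False])
      finally show ?thesis using False unfolding z by blast
    qed
  qed
qed

end
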